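(* If there is a Mahlo cardinal, then the least Mahlo cardinal is second-order sententially categorical but not first-order theory categorical.
   Context: $V_\kappa$ is the rank-initial segment of the cumulative hierarchy; second-order sentences in $V_\kappa$ have second-order quantifiers ranging over all subsets of $V_\kappa$. A cardinal $\kappa$ is second-order sententially categorical if there is a second-order sentence $\sigma$ such that $\kappa$ is inaccessible, $V_\kappa\models\sigma$, and $V_\lambda\not\models\sigma$ for every inaccessible $\lambda\neq\kappa$. It is first-order theory categorical if $\kappa$ is inaccessible and there is a first-order theory $T$ with $V_\kappa\models T$ and $V_\lambda\not\models T$ for every inaccessible $\lambda\neq\kappa$. *)

theory Defs
  imports "HOL-Library.Equipollence" "HOL-Library.Countable_Set"
begin

section \<open>The universe of sets\<close>

text \<open>
  The elements of a type of this class are the sets of a universe \<open>V\<close> of ZFC. In the two axiom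
  schemes the formula is an arbitrary HOL predicate, so every HOL-subset of a set, and every
  HOL-function between two sets, is itself a set of the universe. Powersets, bijections, cofinal
  maps, closed unbounded sets and the range of second-order quantifiers can therefore be taken at
  the level of HOL without a change of meaning.
\<close>

class zfc_universe =
  fixes mem :: "'a \<Rightarrow> 'a \<Rightarrow> bool"  (infix \<open>\<in>\<^sub>V\<close> 50)
  assumes extensionality: "(\<And>z. z \<in>\<^sub>V x \<longleftrightarrow> z \<in>\<^sub>V y) \<Longrightarrow> x = y"
    and foundation: "z \<in>\<^sub>V x \<Longrightarrow> \<exists>y. y \<in>\<^sub>V x \<and> \<not> (\<exists>w. w \<in>\<^sub>V y \<and> w \<in>\<^sub>V x)"
    and pairing: "\<exists>p. \<forall>z. z \<in>\<^sub>V p \<longleftrightarrow> z = x \<or> z = y"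
    and union: "\<exists>u. \<forall>z. z \<in>\<^sub>V u \<longleftrightarrow> (\<exists>y. y \<in>\<^sub>V x \<and> z \<in>\<^sub>V y)"
    and powerset: "\<exists>p. \<forall>z. z \<in>\<^sub>V p \<longleftrightarrow> (\<forall>w. w \<in>\<^sub>V z \<longrightarrow> w \<in>\<^sub>V x)"
    and infinity: "\<exists>x. (\<exists>e. e \<in>\<^sub>V x \<and> (\<forall>z. \<not> z \<in>\<^sub>V e)) \<and>
        (\<forall>y. y \<in>\<^sub>V x \<longrightarrow> (\<exists>s. s \<in>\<^sub>V x \<and> (\<forall>z. z \<in>\<^sub>V s \<longleftrightarrow> z \<in>\<^sub>V y \<or> z = y)))"
    and separation: "\<exists>y. \<forall>z. z \<in>\<^sub>V y \<longleftrightarrow> z \<in>\<^sub>V x \<and> P z"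
    and replacement: "(\<And>u v v'. u \<in>\<^sub>V x \<Longrightarrow> R u v \<Longrightarrow> R u v' \<Longrightarrow> v = v') \<Longrightarrow>
        \<exists>y. \<forall>v. v \<in>\<^sub>V y \<longleftrightarrow> (\<exists>u. u \<in>\<^sub>V x \<and> R u v)"
    and choice: "(\<And>y. y \<in>\<^sub>V x \<Longrightarrow> \<exists>z. z \<in>\<^sub>V y) \<Longrightarrow>
        (\<And>y y' z. y \<in>\<^sub>V x \<Longrightarrow> y' \<in>\<^sub>V x \<Longrightarrow> z \<in>\<^sub>V y \<Longrightarrow> z \<in>\<^sub>V y' \<Longrightarrow> y = y') \<Longrightarrow>
        \<exists>c. \<forall>y. y \<in>\<^sub>V x \<longrightarrow> (\<exists>!z. z \<in>\<^sub>V y \<and> z \<in>\<^sub>V c)"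

definition elts :: "'v::zfc_universe \<Rightarrow> 'v set" where
  "elts x = {y. y \<in>\<^sub>V x}"

section \<open>Ordinals, cardinals and the cumulative hierarchy\<close>

definition transitive_set :: "'v::zfc_universe \<Rightarrow> bool" where
  "transitive_set x \<longleftrightarrow> (\<forall>y \<in> elts x. elts y \<subseteq> elts x)"

text \<open>In the presence of foundation, a transitive set of transitive sets is well-ordered by membership.\<close>

definition ordinal :: "'v::zfc_universe \<Rightarrow> bool" where
  "ordinal \<alpha> \<longleftrightarrow> transitive_set \<alpha> \<and> (\<forall>\<beta> \<in> elts \<alpha>. transitive_set \<beta>)"

definition cardinal :: "'v::zfc_universe \<Rightarrow> bool" where
  "cardinal \<kappa> \<longleftrightarrow> ordinal \<kappa> \<and> (\<forall>\<alpha> \<in> elts \<kappa>. \<not> elts \<alpha> \<approx> elts \<kappa>)"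

definition regular :: "'v::zfc_universe \<Rightarrow> bool" where
  "regular \<kappa> \<longleftrightarrow> cardinal \<kappa> \<and> infinite (elts \<kappa>) \<and>
     (\<forall>\<alpha> \<in> elts \<kappa>. \<forall>f. f ` elts \<alpha> \<subseteq> elts \<kappa> \<longrightarrow> (\<exists>\<beta> \<in> elts \<kappa>. f ` elts \<alpha> \<subseteq> elts \<beta>))"

definition strong_limit :: "'v::zfc_universe \<Rightarrow> bool" where
  "strong_limit \<kappa> \<longleftrightarrow> cardinal \<kappa> \<and> (\<forall>\<alpha> \<in> elts \<kappa>. Pow (elts \<alpha>) \<prec> elts \<kappa>)"

definition inaccessible :: "'v::zfc_universe \<Rightarrow> bool" where
  "inaccessible \<kappa> \<longleftrightarrow> regular \<kappa> \<and> strong_limit \<kappa> \<and> uncountable (elts \<kappa>)"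

text \<open>
  \<open>in_V \<alpha> x\<close> says that \<open>x\<close> belongs to \<open>V\<^sub>\<alpha>\<close>, the union of the powersets of \<open>V\<^sub>\<beta>\<close> for \<open>\<beta> < \<alpha>\<close>.
\<close>

inductive in_V :: "'v::zfc_universe \<Rightarrow> 'v \<Rightarrow> bool" where
  "\<beta> \<in>\<^sub>V \<alpha> \<Longrightarrow> (\<forall>y. y \<in>\<^sub>V x \<longrightarrow> in_V \<beta> y) \<Longrightarrow> in_V \<alpha> x"

definition Vset :: "'v::zfc_universe \<Rightarrow> 'v set" where
  "Vset \<alpha> = {x. in_V \<alpha> x}"

lemma Vset_eq: "Vset \<alpha> = (\<Union>\<beta> \<in> elts \<alpha>. {x. elts x \<subseteq> Vset \<beta>})"
proof (rule set_eqI)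
  fix x
  have "in_V \<alpha> x \<longleftrightarrow> (\<exists>\<beta>. \<beta> \<in>\<^sub>V \<alpha> \<and> (\<forall>y. y \<in>\<^sub>V x \<longrightarrow> in_V \<beta> y))"
    by (subst in_V.simps) simp
  then show "x \<in> Vset \<alpha> \<longleftrightarrow> x \<in> (\<Union>\<beta> \<in> elts \<alpha>. {x. elts x \<subseteq> Vset \<beta>})"
    by (auto simp: Vset_def elts_def)
qed

section \<open>Mahlo cardinals\<close>

definition unbounded_in :: "'v::zfc_universe set \<Rightarrow> 'v \<Rightarrow> bool" where
  "unbounded_in C \<alpha> \<longleftrightarrow> (\<forall>\<beta> \<in> elts \<alpha>. \<exists>\<gamma> \<in> C \<inter> elts \<alpha>. \<beta> \<in>\<^sub>V \<gamma>)"

text \<open>A nonempty ordinal in which some \<open>C\<close> is unbounded is a limit ordinal.\<close>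

definition closed_in :: "'v::zfc_universe set \<Rightarrow> 'v \<Rightarrow> bool" where
  "closed_in C \<kappa> \<longleftrightarrow> (\<forall>\<alpha> \<in> elts \<kappa>. elts \<alpha> \<noteq> {} \<and> unbounded_in C \<alpha> \<longrightarrow> \<alpha> \<in> C)"

definition club :: "'v::zfc_universe set \<Rightarrow> 'v \<Rightarrow> bool" where
  "club C \<kappa> \<longleftrightarrow> C \<subseteq> elts \<kappa> \<and> closed_in C \<kappa> \<and> unbounded_in C \<kappa>"

definition stationary :: "'v::zfc_universe set \<Rightarrow> 'v \<Rightarrow> bool" where
  "stationary S \<kappa> \<longleftrightarrow> (\<forall>C. club C \<kappa> \<longrightarrow> S \<inter> C \<noteq> {})"

definition Mahlo :: "'v::zfc_universe \<Rightarrow> bool" where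
  "Mahlo \<kappa> \<longleftrightarrow> inaccessible \<kappa> \<and> stationary {\<mu> \<in> elts \<kappa>. inaccessible \<mu>} \<kappa>"

definition least_Mahlo :: "'v::zfc_universe \<Rightarrow> bool" where
  "least_Mahlo \<kappa> \<longleftrightarrow> Mahlo \<kappa> \<and> (\<forall>\<mu>. Mahlo \<mu> \<longrightarrow> \<kappa> = \<mu> \<or> \<kappa> \<in>\<^sub>V \<mu>)"

section \<open>The second-order language of set theory\<close>

text \<open>
  First-order and second-order variables are two disjoint sorts, each indexed by the natural
  numbers. \<open>InSet m n\<close> says that first-order variable \<open>m\<close> belongs to second-order variable \<open>n\<close>.
\<close>

datatype fm =
    Mem nat nat
  | Eq nat nat
  | InSet nat nat
  | Neg fm
  | Conj fm fm
  | Forall nat fm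
  | ForallSet nat fm

primrec fo_free_vars :: "fm \<Rightarrow> nat set" where
  "fo_free_vars (Mem m n) = {m, n}"
| "fo_free_vars (Eq m n) = {m, n}"
| "fo_free_vars (InSet m n) = {m}"
| "fo_free_vars (Neg \<phi>) = fo_free_vars \<phi>"
| "fo_free_vars (Conj \<phi> \<psi>) = fo_free_vars \<phi> \<union> fo_free_vars \<psi>"
| "fo_free_vars (Forall n \<phi>) = fo_free_vars \<phi> - {n}"
| "fo_free_vars (ForallSet n \<phi>) = fo_free_vars \<phi>"

primrec so_free_vars :: "fm \<Rightarrow> nat set" where
  "so_free_vars (Mem m n) = {}"
| "so_free_vars (Eq m n) = {}"
| "so_free_vars (InSet m n) = {n}"
| "so_free_vars (Neg \<phi>) = so_free_vars \<phi>"
| "so_free_vars (Conj \<phi> \<psi>) = so_free_vars \<phi> \<union> so_free_vars \<psi>"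
| "so_free_vars (Forall n \<phi>) = so_free_vars \<phi>"
| "so_free_vars (ForallSet n \<phi>) = so_free_vars \<phi> - {n}"

definition sentence :: "fm \<Rightarrow> bool" where
  "sentence \<phi> \<longleftrightarrow> fo_free_vars \<phi> = {} \<and> so_free_vars \<phi> = {}"

primrec first_order :: "fm \<Rightarrow> bool" where
  "first_order (Mem m n) \<longleftrightarrow> True"
| "first_order (Eq m n) \<longleftrightarrow> True"
| "first_order (InSet m n) \<longleftrightarrow> False"
| "first_order (Neg \<phi>) \<longleftrightarrow> first_order \<phi>"
| "first_order (Conj \<phi> \<psi>) \<longleftrightarrow> first_order \<phi> \<and> first_order \<psi>"
| "first_order (Forall n \<phi>) \<longleftrightarrow> first_order \<phi>"
| "first_order (ForallSet n \<phi>) \<longleftrightarrow> False"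

definition first_order_theory :: "fm set \<Rightarrow> bool" where
  "first_order_theory T \<longleftrightarrow> (\<forall>\<phi> \<in> T. first_order \<phi> \<and> sentence \<phi>)"

primrec sat :: "'v::zfc_universe set \<Rightarrow> (nat \<Rightarrow> 'v) \<Rightarrow> (nat \<Rightarrow> 'v set) \<Rightarrow> fm \<Rightarrow> bool" where
  "sat M e E (Mem m n) \<longleftrightarrow> e m \<in>\<^sub>V e n"
| "sat M e E (Eq m n) \<longleftrightarrow> e m = e n"
| "sat M e E (InSet m n) \<longleftrightarrow> e m \<in> E n"
| "sat M e E (Neg \<phi>) \<longleftrightarrow> \<not> sat M e E \<phi>"
| "sat M e E (Conj \<phi> \<psi>) \<longleftrightarrow> sat M e E \<phi> \<and> sat M e E \<psi>"
| "sat M e E (Forall n \<phi>) \<longleftrightarrow> (\<forall>x \<in> M. sat M (e(n := x)) E \<phi>)"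
| "sat M e E (ForallSet n \<phi>) \<longleftrightarrow> (\<forall>X. X \<subseteq> M \<longrightarrow> sat M e (E(n := X)) \<phi>)"

definition models :: "'v::zfc_universe set \<Rightarrow> fm \<Rightarrow> bool"  (infix \<open>\<Turnstile>\<close> 50) where
  "M \<Turnstile> \<phi> \<longleftrightarrow> (\<forall>e E. range e \<subseteq> M \<longrightarrow> (\<forall>n. E n \<subseteq> M) \<longrightarrow> sat M e E \<phi>)"

definition models_theory :: "'v::zfc_universe set \<Rightarrow> fm set \<Rightarrow> bool" where
  "models_theory M T \<longleftrightarrow> (\<forall>\<phi> \<in> T. M \<Turnstile> \<phi>)"

section \<open>Categorical cardinals\<close>

definition second_order_sententially_categorical :: "'v::zfc_universe \<Rightarrow> bool" where
  "second_order_sententially_categorical \<kappa> \<longleftrightarrow>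
     (\<exists>\<sigma>. sentence \<sigma> \<and> inaccessible \<kappa> \<and> Vset \<kappa> \<Turnstile> \<sigma> \<and>
        (\<forall>\<mu>. inaccessible \<mu> \<and> \<mu> \<noteq> \<kappa> \<longrightarrow> \<not> Vset \<mu> \<Turnstile> \<sigma>))"

definition first_order_theory_categorical :: "'v::zfc_universe \<Rightarrow> bool" where
  "first_order_theory_categorical \<kappa> \<longleftrightarrow> inaccessible \<kappa> \<and>
     (\<exists>T. first_order_theory T \<and> models_theory (Vset \<kappa>) T \<and>
        (\<forall>\<mu>. inaccessible \<mu> \<and> \<mu> \<noteq> \<kappa> \<longrightarrow> \<not> models_theory (Vset \<mu>) T))"

end

theory Submission
  imports Defs
begin

text \<open>
  Inaccessible cardinals are the heights of those \<open>Y\<close> that are transitive and closed under powersets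
  and second-order replacement. This characterization can be expressed in \<open>V\<^sub>\<kappa>\<close> with second-order
  quantifiers, and hence so can ``the inaccessibles are stationary in \<open>\<kappa>\<close> and in no inaccessible
  \<open>\<mu> < \<kappa>\<close>'', which holds exactly when \<open>\<kappa>\<close> is the least Mahlo cardinal.

  For a Mahlo cardinal \<open>\<kappa>\<close>, the ordinals below \<open>\<kappa>\<close> that are closed under bounds for Skolem
  witnesses of all first-order formulas form a closed unbounded set, which therefore contains an
  inaccessible \<open>\<mu>\<close>. Then \<open>V\<^sub>\<mu>\<close> is an elementary submodel of \<open>V\<^sub>\<kappa>\<close>, so no first-order theory
  singles out \<open>\<kappa>\<close>.
\<close>

section \<open>Sets and ordinals\<close>

text \<open>Only unary second-order variables are available, so cardinalities and functions cannot
  be spoken of directly inside V_\<kappa>. Inaccessibility of \<mu> is therefore tested through a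
  class \<open>Y\<close> whose ordinals are those below \<mu>. Replacement in \<open>Y\<close>
  yields transitive bounding sets; the ordinals of such a set form an ordinal in \<open>Y\<close>,
  hence one below \<mu>. So no member of \<open>Y\<close> maps onto \<mu>, and regularity, the
  strong limit property and uncountability all rest on this.

  Each \<mu> < \<kappa> is an element of V_\<kappa>, but \<kappa> is only a class. The stationarity
  formula takes its ordinal as a class variable, so that one formula serves both. Clubs in \<mu> are
  subsets of V_\<kappa>, hence stationarity in \<mu> is read correctly in V_\<kappa>.

  The elementary submodel argument uses inaccessibility twice: of \<kappa>, to bound the Skolem
  witnesses for all assignments into V_\<alpha> and all formulas at once; of \<mu>, to place the
  countable range of an assignment inside some V_\<beta> with \<beta> < \<mu>.\<close>

lemma mem_iff_elts: "x \<in>\<^sub>V y \<longleftrightarrow> x \<in> elts y"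
  by (simp add: elts_def)

lemma elts_inject: "elts x = elts y \<longleftrightarrow> x = y"
proof
  assume "elts x = elts y"
  then show "x = y"
    by (intro extensionality) (auto simp: mem_iff_elts)
qed simp

lemma ex_elts_subset:
  assumes "A \<subseteq> elts x" obtains y where "elts y = A"
proof -
  obtain y where "\<forall>z. z \<in>\<^sub>V y \<longleftrightarrow> z \<in>\<^sub>V x \<and> z \<in> A"
    using separation[of x "\<lambda>z. z \<in> A"] by blast
  then have "elts y = A"
    using assms by (auto simp: mem_iff_elts)
  then show ?thesis by (rule that)
qed

lemma ex_elts_image:
  fixes f :: "'v::zfc_universe \<Rightarrow> 'v"
  obtains y where "elts y = f ` elts x"
proof -
  have "\<exists>y. \<forall>v. v \<in>\<^sub>V y \<longleftrightarrow> (\<exists>u. u \<in>\<^sub>V x \<and> v = f u)"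
    by (rule replacement[where R = "\<lambda>u v. v = f u"]) simp
  then obtain y where "\<forall>v. v \<in>\<^sub>V y \<longleftrightarrow> (\<exists>u. u \<in>\<^sub>V x \<and> v = f u)"
    by blast
  then have "elts y = f ` elts x"
    by (auto simp: mem_iff_elts)
  then show ?thesis by (rule that)
qed

lemma ex_elts_pair: obtains p where "elts p = {x, y}"
proof -
  obtain p where "\<forall>z. z \<in>\<^sub>V p \<longleftrightarrow> z = x \<or> z = y"
    using pairing[of x y] by blast
  then have "elts p = {x, y}"
    by (auto simp: mem_iff_elts)
  then show ?thesis by (rule that)
qed

lemma ex_elts_Union: obtains u where "elts u = (\<Union>y \<in> elts x. elts y)"
proof -
  obtain u where "\<forall>z. z \<in>\<^sub>V u \<longleftrightarrow> (\<exists>y. y \<in>\<^sub>V x \<and> z \<in>\<^sub>V y)"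
    using union[of x] by blast
  then have "elts u = (\<Union>y \<in> elts x. elts y)"
    by (auto simp: mem_iff_elts)
  then show ?thesis by (rule that)
qed

lemma ex_elts_succ: obtains s where "elts s = insert x (elts x)"
proof -
  obtain q where q: "elts q = {x, x}" by (rule ex_elts_pair)
  obtain p where p: "elts p = {x, q}" by (rule ex_elts_pair)
  obtain s where "elts s = (\<Union>y \<in> elts p. elts y)" by (rule ex_elts_Union)
  then have "elts s = insert x (elts x)" by (auto simp: p q)
  then show ?thesis by (rule that)
qed

lemma ex_mem_minimal:
  assumes "A \<subseteq> elts x" "A \<noteq> {}" obtains y where "y \<in> A" "elts y \<inter> A = {}"
proof -
  obtain a where a: "elts a = A" using assms(1) by (rule ex_elts_subset)
  obtain z where "z \<in>\<^sub>V a" using assms(2) a by (auto simp: mem_iff_elts)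
  from foundation[OF this] show ?thesis
    using that a by (auto simp: mem_iff_elts)
qed

lemma not_mem_self: "x \<notin> elts x"
proof
  assume "x \<in> elts x"
  then have "{x} \<subseteq> elts x" "{x} \<noteq> {}" by auto
  then show False
    by (rule ex_mem_minimal) (use \<open>x \<in> elts x\<close> in auto)
qed

section \<open>Ordinals: least elements, induction, comparability, suprema\<close>

lemma ordinal_elem: "ordinal \<alpha> \<Longrightarrow> \<beta> \<in> elts \<alpha> \<Longrightarrow> ordinal \<beta>"
  unfolding ordinal_def transitive_set_def by blast

lemma ordinal_trans: "ordinal \<alpha> \<Longrightarrow> \<beta> \<in> elts \<alpha> \<Longrightarrow> \<gamma> \<in> elts \<beta> \<Longrightarrow> \<gamma> \<in> elts \<alpha>"
  unfolding ordinal_def transitive_set_def by blast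

lemma ordinal_least:
  assumes "ordinal \<alpha>" "P \<alpha>"
  obtains \<mu> where "ordinal \<mu>" "P \<mu>" "\<And>\<beta>. \<beta> \<in> elts \<mu> \<Longrightarrow> \<not> P \<beta>"
proof -
  \<comment> \<open>Foundation is applied inside the successor of \<alpha>, so that \<alpha> itself
    is among the candidates.\<close>
  obtain s where s: "elts s = insert \<alpha> (elts \<alpha>)" by (rule ex_elts_succ)
  have "{\<beta> \<in> elts s. P \<beta>} \<subseteq> elts s" "{\<beta> \<in> elts s. P \<beta>} \<noteq> {}"
    using assms s by auto
  then obtain \<mu> where \<mu>: "\<mu> \<in> {\<beta> \<in> elts s. P \<beta>}" "elts \<mu> \<inter> {\<beta> \<in> elts s. P \<beta>} = {}"
    by (rule ex_mem_minimal)
  then have "\<mu> = \<alpha> \<or> \<mu> \<in> elts \<alpha>" using s by blast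
  then have "ordinal \<mu>" and "elts \<mu> \<subseteq> elts s"
    using s assms(1) ordinal_elem[OF assms(1)] ordinal_trans[OF assms(1)] by blast+
  show ?thesis
  proof (rule that)
    show "ordinal \<mu>" "P \<mu>" using \<mu> \<open>ordinal \<mu>\<close> by auto
    show "\<not> P \<beta>" if "\<beta> \<in> elts \<mu>" for \<beta> using that \<mu>(2) \<open>elts \<mu> \<subseteq> elts s\<close> by blast
  qed
qed

lemma ordinal_induct [consumes 1, case_names step]:
  assumes "ordinal \<alpha>"
    and step: "\<And>\<beta>. ordinal \<beta> \<Longrightarrow> (\<And>\<gamma>. \<gamma> \<in> elts \<beta> \<Longrightarrow> P \<gamma>) \<Longrightarrow> P \<beta>"
  shows "P \<alpha>"
proof (rule ccontr)
  assume "\<not> P \<alpha>"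
  with assms(1) show False
    by (rule ordinal_least[where P = "\<lambda>x. \<not> P x"]) (use step in blast)
qed

text \<open>Nested induction, first on \<alpha> for all \<beta>, then on \<beta>: if neither ordinal
  belongs to the other, every element of one lies in the other, and extensionality makes them
  equal.\<close>

lemma ordinal_linear:
  assumes "ordinal \<alpha>" "ordinal \<beta>"
  shows "\<alpha> \<in> elts \<beta> \<or> \<alpha> = \<beta> \<or> \<beta> \<in> elts \<alpha>"
  using assms
proof (induction arbitrary: \<beta> rule: ordinal_induct)
  case (step \<alpha>)
  note IH = step.IH and \<alpha> = step.hyps
  from \<open>ordinal \<beta>\<close> show ?case
  proof (induction rule: ordinal_induct)
    case (step \<beta>)
    show ?case
    proof (rule ccontr)
      assume neg: "\<not> ?case"
      have "c \<in> elts \<beta>" if "c \<in> elts \<alpha>" for c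
        using IH[OF that step.hyps] neg that ordinal_trans[OF \<alpha> that] by blast
      moreover have "c \<in> elts \<alpha>" if "c \<in> elts \<beta>" for c
        using step.IH[OF that] neg that ordinal_trans[OF step.hyps that] by blast
      ultimately have "elts \<alpha> = elts \<beta>" by blast
      then show False using neg by (simp add: elts_inject)
    qed
  qed
qed

lemma ordinal_subset_iff:
  assumes "ordinal \<alpha>" "ordinal \<beta>"
  shows "elts \<alpha> \<subseteq> elts \<beta> \<longleftrightarrow> \<alpha> \<in> elts \<beta> \<or> \<alpha> = \<beta>"
  using ordinal_linear[OF assms] ordinal_trans[OF assms(2), of \<alpha>] not_mem_self[of \<beta>] by blast

lemma ordinal_subset_mem:
  assumes "ordinal \<kappa>" "ordinal \<alpha>" "elts \<alpha> \<subseteq> elts \<beta>" "\<beta> \<in> elts \<kappa>"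
  shows "\<alpha> \<in> elts \<kappa>"
  using ordinal_subset_iff[OF assms(2) ordinal_elem[OF assms(1,4)]] ordinal_trans[OF assms(1,4)] assms
  by blast

text \<open>Turns a transitive bound into an ordinal bound.\<close>

lemma ordinal_ordinals:
  assumes "transitive_set s" "elts \<alpha> = {x \<in> elts s. ordinal x}"
  shows "ordinal \<alpha>"
proof -
  have "transitive_set \<alpha>"
    using assms(1) ordinal_elem unfolding assms(2) transitive_set_def by blast
  moreover have "transitive_set \<beta>" if "\<beta> \<in> elts \<alpha>" for \<beta>
    using that assms(2) by (simp add: ordinal_def)
  ultimately show ?thesis by (simp add: ordinal_def)
qed

lemma ordinal_sup:
  assumes "ordinal \<beta>" "A \<subseteq> elts \<beta>"
  obtains \<delta> where "ordinal \<delta>" "elts \<delta> = (\<Union>a \<in> A. elts a)" "elts \<delta> \<subseteq> elts \<beta>"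
proof -
  have sub: "(\<Union>a \<in> A. elts a) \<subseteq> elts \<beta>"
    using assms ordinal_trans by blast
  then obtain \<delta> where \<delta>: "elts \<delta> = (\<Union>a \<in> A. elts a)" by (rule ex_elts_subset)
  have "transitive_set \<delta>"
    unfolding transitive_set_def \<delta> using assms ordinal_elem[OF assms(1)] ordinal_trans by blast
  moreover have "transitive_set x" if "x \<in> elts \<delta>" for x
    using that sub \<delta> assms(1) by (auto simp: ordinal_def)
  ultimately have "ordinal \<delta>" by (simp add: ordinal_def)
  then show ?thesis using that \<delta> sub by simp
qed

section \<open>Sets of size less than an inaccessible cardinal\<close>

text \<open>The measured set may have any HOL type, so that assignments and formulas can be counted
  as well as sets of the universe.\<close>

definition small :: "'v::zfc_universe \<Rightarrow> 'a set \<Rightarrow> bool" where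
  "small \<kappa> A \<longleftrightarrow> (\<exists>\<alpha> \<in> elts \<kappa>. A \<lesssim> elts \<alpha>)"

lemma lepoll_linear: "A \<lesssim> B \<or> B \<lesssim> A"
  unfolding lepoll_def card_of_ordLeq
  by (rule ordLeq_total) (rule card_of_Well_order)+

unbundle cardinal_syntax

lemma lesspoll_iff_card_of: "A \<prec> B \<longleftrightarrow> |A| <o |B|"
proof -
  have "A \<prec> B \<longleftrightarrow> \<not> B \<lesssim> A"
    using lepoll_linear[of A B] lepoll_antisym[of A B] eqpoll_imp_lepoll[OF eqpoll_sym, of A B]
    unfolding lesspoll_def by blast
  also have "\<dots> \<longleftrightarrow> |A| <o |B|"
    unfolding lepoll_def card_of_ordLeq
    by (rule not_ordLeq_iff_ordLess) (rule card_of_Well_order)+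
  finally show ?thesis .
qed

text \<open>Connects membership with the well-orders of the cardinal library, where the strict
  comparison of \<open>lesspoll_iff_card_of\<close> produces a proper initial segment.\<close>

lemma ordinal_Well_order:
  assumes "ordinal \<kappa>"
  defines "r \<equiv> {(x, y). x \<in> elts \<kappa> \<and> y \<in> elts \<kappa> \<and> (x \<in> elts y \<or> x = y)}"
  shows "well_order_on (elts \<kappa>) r"
proof -
  have lin: "linear_order_on (elts \<kappa>) r"
  proof -
    have "refl_on (elts \<kappa>) r" "r \<subseteq> elts \<kappa> \<times> elts \<kappa>"
      by (auto simp: refl_on_def r_def)
    moreover have "trans r"
      unfolding trans_def r_def using ordinal_elem[OF assms(1)] ordinal_trans by blast
    moreover have "antisym r"
      unfolding antisym_def r_def
      using ordinal_elem[OF assms(1)] ordinal_trans not_mem_self by blast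
    moreover have "total_on (elts \<kappa>) r"
      unfolding total_on_def r_def using ordinal_elem[OF assms(1)] ordinal_linear by blast
    ultimately show ?thesis by (simp add: order_on_defs)
  qed
  have "wf (r - Id)"
  proof (rule wfI_min)
    fix x :: 'a and Q assume x: "x \<in> Q"
    show "\<exists>z \<in> Q. \<forall>y. (y, z) \<in> r - Id \<longrightarrow> y \<notin> Q"
    proof (cases "Q \<inter> elts \<kappa> = {}")
      case True
      then show ?thesis using x by (auto simp: r_def)
    next
      case False
      then obtain y where "y \<in> Q \<inter> elts \<kappa>" "elts y \<inter> (Q \<inter> elts \<kappa>) = {}"
        using ex_mem_minimal[of "Q \<inter> elts \<kappa>" \<kappa>] by blast
      then show ?thesis by (auto simp: r_def)
    qed
  qed
  with lin show ?thesis by (simp add: well_order_on_def)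
qed

text \<open>A cardinal strictly below the order type of \<kappa> is isomorphic to a proper initial
  segment of \<kappa>, and such a segment is contained in an element of \<kappa>. This brings the
  strong limit property into the form \<open>small\<close>.\<close>

lemma lesspoll_ordinal_imp_small:
  assumes "ordinal \<kappa>" "A \<prec> elts \<kappa>"
  shows "small \<kappa> A"
proof -
  define r where "r = {(x, y). x \<in> elts \<kappa> \<and> y \<in> elts \<kappa> \<and> (x \<in> elts y \<or> x = y)}"
  have wo: "well_order_on (elts \<kappa>) r"
    unfolding r_def by (rule ordinal_Well_order[OF assms(1)])
  then have fld: "Field r = elts \<kappa>" "Well_order r"
    using well_order_on_Well_order[OF wo] by auto
  have "|A| <o |elts \<kappa>|" using assms(2) by (simp add: lesspoll_iff_card_of)
  also have "|elts \<kappa>| \<le>o r" by (rule card_of_least[OF wo])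
  finally have "|A| <o r" .
  then obtain a where a: "a \<in> Field r" "|A| =o Restr r (underS r a)"
    using ordLess_iff_ordIso_Restr[OF fld(2) card_of_Well_order] by blast
  have "Field (Restr r (underS r a)) \<subseteq> elts a"
    by (auto simp: Field_def underS_def r_def)
  moreover have "|A| =o |Field (Restr r (underS r a))|"
    using card_of_cong[OF a(2)] unfolding Field_card_of .
  ultimately have "|A| \<le>o |elts a|"
    using card_of_mono1 ordIso_ordLeq_trans by blast
  then have "A \<lesssim> elts a" unfolding lepoll_def card_of_ordLeq .
  then show ?thesis using a(1) fld by (auto simp: small_def)
qed

lemma small_subset: "small \<kappa> A \<Longrightarrow> B \<subseteq> A \<Longrightarrow> small \<kappa> B"
  unfolding small_def using subset_imp_lepoll lepoll_trans by blast

lemma small_lepoll: "small \<kappa> A \<Longrightarrow> B \<lesssim> A \<Longrightarrow> small \<kappa> B"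
  unfolding small_def using lepoll_trans by blast

lemma small_image: "small \<kappa> A \<Longrightarrow> small \<kappa> (f ` A)"
  using small_lepoll image_lepoll by blast

lemma small_elem: "\<alpha> \<in> elts \<kappa> \<Longrightarrow> small \<kappa> (elts \<alpha>)"
  unfolding small_def by blast

lemma small_eq_image:
  assumes "small \<kappa> A" "A \<noteq> {}"
  obtains \<alpha> g where "\<alpha> \<in> elts \<kappa>" "A = g ` elts \<alpha>"
proof -
  obtain \<alpha> f where f: "\<alpha> \<in> elts \<kappa>" "inj_on f A" "f ` A \<subseteq> elts \<alpha>"
    using assms(1) unfolding small_def lepoll_def by blast
  \<comment> \<open>The default value \<open>a\<close> keeps the partial inverse of \<open>f\<close>
    inside \<open>A\<close> on all of \<open>elts \<alpha>\<close>.\<close>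
  obtain a where a: "a \<in> A" using assms(2) by blast
  define g where "g x = (if x \<in> f ` A then the_inv_into A f x else a)" for x
  have "g ` elts \<alpha> \<subseteq> A"
    using a the_inv_into_into[OF f(2) _ subset_refl] by (auto simp: g_def)
  moreover have "x \<in> g ` elts \<alpha>" if "x \<in> A" for x
  proof (rule image_eqI)
    show "x = g (f x)" using that f(2) by (simp add: g_def the_inv_into_f_f)
    show "f x \<in> elts \<alpha>" using that f(3) by blast
  qed
  ultimately have "A = g ` elts \<alpha>" by blast
  then show ?thesis using that f(1) by blast
qed

lemma small_imp_set:
  fixes \<kappa> :: "'v::zfc_universe" and A :: "'v set"
  assumes "small \<kappa> A" obtains x where "elts x = A"
proof (cases "A = {}")
  case True
  then have "A \<subseteq> elts \<kappa>" by simp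
  then show ?thesis using ex_elts_subset that by blast
next
  case False
  with assms obtain \<alpha> g where A: "\<alpha> \<in> elts \<kappa>" "A = g ` elts \<alpha>" by (rule small_eq_image)
  obtain y where "elts y = g ` elts \<alpha>" by (rule ex_elts_image)
  then show ?thesis using that A(2) by blast
qed

lemma infinite_set_imp_countable_lepoll:
  assumes "infinite B" "countable A" shows "A \<lesssim> B"
proof -
  have "A \<lesssim> (UNIV :: nat set)"
    using assms(2) unfolding countable_def lepoll_def by blast
  also have "\<dots> \<lesssim> B" using assms(1) infinite_le_lepoll by blast
  finally show ?thesis .
qed

section \<open>Closure properties of the sets of size less than \<kappa>\<close>

locale inacc =
  fixes \<kappa> :: "'v::zfc_universe"
  assumes inaccessible: "inaccessible \<kappa>"
begin

lemma ordinal: "ordinal \<kappa>"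
  using inaccessible by (simp add: inaccessible_def regular_def cardinal_def)

lemma trans: "\<beta> \<in> elts \<kappa> \<Longrightarrow> \<gamma> \<in> elts \<beta> \<Longrightarrow> \<gamma> \<in> elts \<kappa>"
  by (rule ordinal_trans[OF ordinal])

lemma ordinal_elem: "\<beta> \<in> elts \<kappa> \<Longrightarrow> ordinal \<beta>"
  by (rule ordinal_elem[OF ordinal])

lemma bounded_elem:
  "\<alpha> \<in> elts \<kappa> \<Longrightarrow> f ` elts \<alpha> \<subseteq> elts \<kappa> \<Longrightarrow> \<exists>\<beta> \<in> elts \<kappa>. f ` elts \<alpha> \<subseteq> elts \<beta>"
  using inaccessible unfolding inaccessible_def regular_def by blast

lemma infinite: "infinite (elts \<kappa>)"
  using inaccessible unfolding inaccessible_def regular_def by blast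

lemma ex_succ:
  assumes "\<alpha> \<in> elts \<kappa>" obtains s where "s \<in> elts \<kappa>" "elts s = insert \<alpha> (elts \<alpha>)"
proof -
  obtain s where s: "elts s = insert \<alpha> (elts \<alpha>)" by (rule ex_elts_succ)
  have "ordinal \<alpha>" by (rule ordinal_elem[OF assms])
  then have "ordinal s"
    unfolding ordinal_def transitive_set_def s by blast
  have sub: "elts s \<subseteq> elts \<kappa>" using assms trans[OF assms] by (auto simp: s)
  have "s \<noteq> \<kappa>"
  proof
    assume "s = \<kappa>"
    \<comment> \<open>If \<kappa> were the successor of \<alpha>, the constant map with value
      \<alpha> on the nonempty \<alpha> would be unbounded in \<kappa>, against regularity.\<close>
    then have "elts \<alpha> \<noteq> {}" using infinite s by auto
    then obtain \<beta> where "\<beta> \<in> elts \<kappa>" "\<alpha> \<in> elts \<beta>"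
      using bounded_elem[OF assms, of "\<lambda>_. \<alpha>"] assms by auto
    then have "\<beta> = \<alpha> \<or> \<beta> \<in> elts \<alpha>" using s \<open>s = \<kappa>\<close> by blast
    then show False
      using \<open>\<alpha> \<in> elts \<beta>\<close> not_mem_self[of \<alpha>] ordinal_trans[OF \<open>ordinal \<alpha>\<close>] by blast
  qed
  then have "s \<in> elts \<kappa>"
    using sub ordinal_subset_iff[OF \<open>ordinal s\<close> ordinal] by blast
  then show ?thesis using that s by blast
qed

text \<open>If every element of \<kappa> were finite, distinct ones would have distinct
  cardinalities by comparability, and \<kappa> would be countable.\<close>

lemma ex_infinite: "\<exists>\<alpha> \<in> elts \<kappa>. infinite (elts \<alpha>)"
proof (rule ccontr)
  assume "\<not> ?thesis"
  then have fin: "finite (elts \<alpha>)" if "\<alpha> \<in> elts \<kappa>" for \<alpha> using that by blast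
  have "inj_on (\<lambda>\<alpha>. card (elts \<alpha>)) (elts \<kappa>)"
  proof (rule inj_onI)
    fix \<alpha> \<beta> assume ab: "\<alpha> \<in> elts \<kappa>" "\<beta> \<in> elts \<kappa>" and eq: "card (elts \<alpha>) = card (elts \<beta>)"
    have "elts \<alpha> \<subseteq> elts \<beta> \<or> elts \<beta> \<subseteq> elts \<alpha>"
      using ordinal_linear[of \<alpha> \<beta>] ordinal_subset_iff[of \<alpha> \<beta>] ordinal_subset_iff[of \<beta> \<alpha>]
        ordinal_elem ab by blast
    then have "elts \<alpha> = elts \<beta>"
      using card_subset_eq[OF fin[OF ab(1)]] card_subset_eq[OF fin[OF ab(2)]] eq by metis
    then show "\<alpha> = \<beta>" by (simp add: elts_inject)
  qed
  then have "countable (elts \<kappa>)" by (rule countableI)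
  then show False using inaccessible by (simp add: inaccessible_def)
qed

lemma small_countable: "countable A \<Longrightarrow> small \<kappa> A"
  using ex_infinite infinite_set_imp_countable_lepoll unfolding small_def by metis

lemma bounded:
  assumes "small \<kappa> A" "f ` A \<subseteq> elts \<kappa>" shows "\<exists>\<beta> \<in> elts \<kappa>. f ` A \<subseteq> elts \<beta>"
proof (cases "A = {}")
  case True
  then show ?thesis using infinite by (metis empty_subsetI finite.emptyI image_empty all_not_in_conv)
next
  case False
  with assms(1) obtain \<alpha> g where A: "\<alpha> \<in> elts \<kappa>" "A = g ` elts \<alpha>" by (rule small_eq_image)
  show ?thesis
    using bounded_elem[OF A(1), of "f \<circ> g"] assms(2) unfolding A(2) image_comp by blast
qed

lemma small_Pow: assumes "small \<kappa> A" shows "small \<kappa> (Pow A)"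
proof -
  obtain \<alpha> where \<alpha>: "\<alpha> \<in> elts \<kappa>" "A \<lesssim> elts \<alpha>" using assms by (auto simp: small_def)
  then have "Pow A \<lesssim> Pow (elts \<alpha>)" by (simp add: lepoll_Pow_self lepoll_def)
      (metis image_Pow_mono inj_on_image_Pow)
  moreover have "Pow (elts \<alpha>) \<prec> elts \<kappa>"
    using inaccessible \<alpha>(1) by (simp add: inaccessible_def strong_limit_def)
  then have "small \<kappa> (Pow (elts \<alpha>))"
    by (rule lesspoll_ordinal_imp_small[OF ordinal])
  ultimately show ?thesis using small_lepoll by blast
qed

text \<open>Both factors embed into one infinite \<gamma> < \<kappa>, and an infinite set absorbs
  its square.\<close>

lemma small_Times:
  assumes "small \<kappa> A" "small \<kappa> B" shows "small \<kappa> (A \<times> B)"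
proof -
  obtain \<alpha> \<beta> where ab: "\<alpha> \<in> elts \<kappa>" "A \<lesssim> elts \<alpha>" "\<beta> \<in> elts \<kappa>" "B \<lesssim> elts \<beta>"
    using assms by (auto simp: small_def)
  obtain \<omega> where \<omega>: "\<omega> \<in> elts \<kappa>" "infinite (elts \<omega>)" using ex_infinite by blast
  have max: "\<exists>\<gamma> \<in> elts \<kappa>. elts \<alpha> \<subseteq> elts \<gamma> \<and> elts \<beta> \<subseteq> elts \<gamma>"
    if "\<alpha> \<in> elts \<kappa>" "\<beta> \<in> elts \<kappa>" for \<alpha> \<beta>
    using ordinal_linear[of \<alpha> \<beta>] ordinal_subset_iff[of \<alpha> \<beta>] ordinal_subset_iff[of \<beta> \<alpha>]
        ordinal_elem that by blast
  obtain \<delta> where \<delta>: "\<delta> \<in> elts \<kappa>" "elts \<alpha> \<subseteq> elts \<delta>" "elts \<beta> \<subseteq> elts \<delta>"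
    using max[OF ab(1,3)] by blast
  obtain \<gamma> where \<gamma>: "\<gamma> \<in> elts \<kappa>" "elts \<delta> \<subseteq> elts \<gamma>" "elts \<omega> \<subseteq> elts \<gamma>"
    using max[OF \<delta>(1) \<omega>(1)] by blast
  have "A \<lesssim> elts \<gamma>" "B \<lesssim> elts \<gamma>"
    using ab \<delta> \<gamma> subset_imp_lepoll lepoll_trans by (metis subset_trans)+
  then have "A \<times> B \<lesssim> elts \<gamma> \<times> elts \<gamma>" by (rule times_lepoll_mono)
  also have "elts \<gamma> \<times> elts \<gamma> \<lesssim> elts \<gamma>"
    unfolding lepoll_def card_of_ordLeq
    using card_of_Times_same_infinite[of "elts \<gamma>"] \<omega>(2) \<gamma>(3) finite_subset ordIso_imp_ordLeq by blast
  finally show ?thesis using \<gamma>(1) by (auto simp: small_def)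
qed

text \<open>Regularity bounds all the sizes by a single \<beta> < \<kappa>; the union is then an
  image of \<open>I \<times> elts \<beta>\<close>.\<close>

lemma small_UN:
  assumes "small \<kappa> I" "\<And>i. i \<in> I \<Longrightarrow> small \<kappa> (A i)" shows "small \<kappa> (\<Union>i \<in> I. A i)"
proof -
  have "\<exists>a. \<forall>i \<in> I. a i \<in> elts \<kappa> \<and> A i \<lesssim> elts (a i)"
    using assms(2) unfolding small_def by metis
  then obtain a where a: "\<And>i. i \<in> I \<Longrightarrow> a i \<in> elts \<kappa>" "\<And>i. i \<in> I \<Longrightarrow> A i \<lesssim> elts (a i)"
    by blast
  obtain \<beta> where \<beta>: "\<beta> \<in> elts \<kappa>" "a ` I \<subseteq> elts \<beta>"
    using bounded[OF assms(1), of a] a(1) by blast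
  have sub: "elts (a i) \<subseteq> elts \<beta>" if "i \<in> I" for i
    using that \<beta> ordinal_trans[OF ordinal_elem[OF \<beta>(1)]] by blast
  have "\<exists>f. \<forall>i \<in> I. inj_on (f i) (A i) \<and> f i ` A i \<subseteq> elts \<beta>"
    using a(2) sub unfolding lepoll_def by (metis subset_trans)
  then obtain f where f: "\<And>i. i \<in> I \<Longrightarrow> inj_on (f i) (A i)" "\<And>i. i \<in> I \<Longrightarrow> f i ` A i \<subseteq> elts \<beta>"
    by blast
  have "(\<Union>i \<in> I. A i) \<subseteq> (\<lambda>(i, y). the_inv_into (A i) (f i) y) ` (I \<times> elts \<beta>)"
  proof
    fix x assume "x \<in> (\<Union>i \<in> I. A i)"
    then obtain i where i: "i \<in> I" "x \<in> A i" by blast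
    then have "x = (\<lambda>(i, y). the_inv_into (A i) (f i) y) (i, f i x)"
      using f(1) by (simp add: the_inv_into_f_f)
    moreover have "(i, f i x) \<in> I \<times> elts \<beta>" using i f(2) by blast
    ultimately show "x \<in> (\<lambda>(i, y). the_inv_into (A i) (f i) y) ` (I \<times> elts \<beta>)" by (rule image_eqI)
  qed
  then show ?thesis
    by (rule small_subset[OF small_image[OF small_Times[OF assms(1) small_elem[OF \<beta>(1)]]]])
qed

lemma small_Un:
  assumes "small \<kappa> A" "small \<kappa> B" shows "small \<kappa> (A \<union> B)"
proof -
  have "small \<kappa> (\<Union>b \<in> {True, False}. if b then A else B)"
    by (rule small_UN[OF small_countable]) (use assms in auto)
  then show ?thesis by (simp add: Un_commute)
qed

end

section \<open>The cumulative hierarchy below an inaccessible cardinal\<close>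

lemma Vset_iff: "x \<in> Vset \<alpha> \<longleftrightarrow> (\<exists>\<beta> \<in> elts \<alpha>. elts x \<subseteq> Vset \<beta>)"
  by (subst Vset_eq) blast

lemma Vset_mono:
  assumes "elts \<alpha> \<subseteq> elts \<beta>" shows "Vset \<alpha> \<subseteq> Vset \<beta>"
  using assms Vset_iff[of _ \<alpha>] Vset_iff[of _ \<beta>] by blast

lemma Vset_mono_elem: "ordinal \<alpha> \<Longrightarrow> \<beta> \<in> elts \<alpha> \<Longrightarrow> Vset \<beta> \<subseteq> Vset \<alpha>"
  using Vset_mono ordinal_trans by blast

lemma Vset_trans:
  assumes "ordinal \<alpha>" "x \<in> Vset \<alpha>" shows "elts x \<subseteq> Vset \<alpha>"
  using assms Vset_iff[of x \<alpha>] Vset_mono_elem by blast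

lemma ordinal_in_Vset:
  assumes "ordinal \<alpha>" shows "\<beta> \<in> elts \<alpha> \<Longrightarrow> \<beta> \<in> Vset \<alpha>"
  using assms
proof (induction arbitrary: \<beta> rule: ordinal_induct)
  case (step \<alpha>)
  then have "elts \<beta> \<subseteq> Vset \<beta>" by blast
  then show ?case using step.prems Vset_iff[of \<beta> \<alpha>] by blast
qed

text \<open>By induction, an ordinal whose elements lie in V_\<beta> is contained in \<beta>. Thus
  the height of V_\<alpha> is \<alpha>.\<close>

lemma Vset_ordinals:
  assumes "ordinal \<alpha>" shows "{x \<in> Vset \<alpha>. ordinal x} = elts \<alpha>"
proof -
  have "x \<in> elts \<alpha>" if "x \<in> Vset \<alpha>" "ordinal x" for x
    using assms that
  proof (induction arbitrary: x rule: ordinal_induct)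
    case (step \<alpha>)
    obtain \<beta> where \<beta>: "\<beta> \<in> elts \<alpha>" "elts x \<subseteq> Vset \<beta>"
      using step.prems(1) Vset_iff[of x \<alpha>] by blast
    have "elts x \<subseteq> elts \<beta>"
      using step.IH[OF \<beta>(1)] \<beta>(2) ordinal_elem[OF step.prems(2)] by blast
    then show ?case
      using ordinal_subset_mem[OF step.hyps step.prems(2)] \<beta>(1) by blast
  qed
  then show ?thesis
    using ordinal_in_Vset[OF assms] ordinal_elem[OF assms] by blast
qed

context inacc begin

lemma Vset_elem_rank: 
  assumes "x \<in> Vset \<kappa>" obtains \<beta> where "\<beta> \<in> elts \<kappa>" "x \<in> Vset \<beta>"
proof -
  obtain \<beta> where \<beta>: "\<beta> \<in> elts \<kappa>" "elts x \<subseteq> Vset \<beta>"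
    using assms Vset_iff[of x \<kappa>] by blast
  obtain s where "s \<in> elts \<kappa>" "elts s = insert \<beta> (elts \<beta>)"
    using \<beta>(1) by (rule ex_succ)
  then show ?thesis using that[of s] \<beta>(2) Vset_iff[of x s] by blast
qed

lemma small_Vset: assumes "\<beta> \<in> elts \<kappa>" shows "small \<kappa> (Vset \<beta>)"
proof -
  have "\<beta> \<in> elts \<kappa> \<Longrightarrow> small \<kappa> (Vset \<beta>)"
    using ordinal_elem[OF assms]
  proof (induction rule: ordinal_induct)
    case (step \<beta>)
    have "small \<kappa> {x. elts x \<subseteq> Vset \<gamma>}" if "\<gamma> \<in> elts \<beta>" for \<gamma>
    proof -
      have "small \<kappa> (Pow (Vset \<gamma>))"
        using step.IH[OF that] trans[OF step.prems that] small_Pow by blast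
      moreover have "{x. elts x \<subseteq> Vset \<gamma>} \<lesssim> Pow (Vset \<gamma>)"
        unfolding lepoll_def by (intro exI[of _ elts]) (auto simp: inj_on_def elts_inject)
      ultimately show ?thesis using small_lepoll by blast
    qed
    then show ?case
      by (subst Vset_eq) (rule small_UN[OF small_elem[OF step.prems]])
  qed
  then show ?thesis using assms .
qed

lemma small_subset_Vset:
  assumes "small \<kappa> A" "A \<subseteq> Vset \<kappa>" obtains \<beta> where "\<beta> \<in> elts \<kappa>" "A \<subseteq> Vset \<beta>"
proof -
  have "\<forall>x \<in> A. \<exists>\<beta>. \<beta> \<in> elts \<kappa> \<and> x \<in> Vset \<beta>"
    using assms(2) Vset_elem_rank by blast
  then obtain b where b: "\<forall>x \<in> A. b x \<in> elts \<kappa> \<and> x \<in> Vset (b x)" by metis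
  then obtain \<beta> where "\<beta> \<in> elts \<kappa>" "b ` A \<subseteq> elts \<beta>"
    using bounded[OF assms(1), of b] by blast
  moreover from this have "A \<subseteq> Vset \<beta>"
    using b Vset_mono_elem[OF ordinal_elem] by blast
  ultimately show ?thesis using that by blast
qed

lemma small_elts: "x \<in> Vset \<kappa> \<Longrightarrow> small \<kappa> (elts x)"
  using Vset_iff[of x \<kappa>] small_Vset small_subset by blast

text \<open>Regularity puts a small subset of V_\<kappa> inside a single V_\<beta>. With
  \<open>small_elts\<close>, the elements of V_\<kappa> are exactly its small subsets.\<close>

lemma small_in_Vset: "elts x \<subseteq> Vset \<kappa> \<Longrightarrow> small \<kappa> (elts x) \<Longrightarrow> x \<in> Vset \<kappa>"
  using small_subset_Vset Vset_iff[of x \<kappa>] by metis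

lemma Vset_subset: "x \<in> Vset \<kappa> \<Longrightarrow> elts y \<subseteq> elts x \<Longrightarrow> y \<in> Vset \<kappa>"
  using Vset_iff[of x \<kappa>] Vset_iff[of y \<kappa>] by blast

lemma Vset_pair: "x \<in> Vset \<kappa> \<Longrightarrow> y \<in> Vset \<kappa> \<Longrightarrow> elts p = {x, y} \<Longrightarrow> p \<in> Vset \<kappa>"
  by (rule small_in_Vset) (auto intro: small_countable)

lemma ex_elts_Vset:
  assumes "\<beta> \<in> elts \<kappa>" obtains s where "s \<in> Vset \<kappa>" "elts s = Vset \<beta>" "transitive_set s"
proof -
  obtain s where s: "elts s = Vset \<beta>" using small_Vset[OF assms] by (rule small_imp_set)
  moreover have "s \<in> Vset \<kappa>" using s assms Vset_iff[of s \<kappa>] by blast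
  moreover have "transitive_set s"
    unfolding transitive_set_def s using Vset_trans[OF ordinal_elem[OF assms]] by blast
  ultimately show ?thesis using that by blast
qed

text \<open>Closure under \<open>g\<close> passes to limits because each \<beta> already lies in a
  closed \<gamma> below the limit. Unboundedness comes from iterating a bounding function countably
  often.\<close>

lemma closure_points_club:
  assumes g: "\<And>\<alpha>. \<alpha> \<in> elts \<kappa> \<Longrightarrow> g \<alpha> \<in> elts \<kappa>"
  shows "club {\<alpha> \<in> elts \<kappa>. \<forall>\<beta> \<in> elts \<alpha>. g \<beta> \<in> elts \<alpha>} \<kappa>" (is "club ?C \<kappa>")
proof -
  have "closed_in ?C \<kappa>"
    unfolding closed_in_def unbounded_in_def mem_iff_elts
  proof (intro ballI impI)
    fix \<alpha> assume \<alpha>: "\<alpha> \<in> elts \<kappa>"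
      and unb: "elts \<alpha> \<noteq> {} \<and> (\<forall>\<beta> \<in> elts \<alpha>. \<exists>\<gamma> \<in> ?C \<inter> elts \<alpha>. \<beta> \<in> elts \<gamma>)"
    have "g \<beta> \<in> elts \<alpha>" if \<beta>: "\<beta> \<in> elts \<alpha>" for \<beta>
    proof -
      obtain \<gamma> where "\<gamma> \<in> ?C" "\<gamma> \<in> elts \<alpha>" "\<beta> \<in> elts \<gamma>" using unb \<beta> by blast
      then show ?thesis using ordinal_trans[OF ordinal_elem[OF \<alpha>]] by blast
    qed
    then show "\<alpha> \<in> ?C" using \<alpha> by blast
  qed
  moreover have "\<exists>\<gamma> \<in> ?C. \<beta> \<in> elts \<gamma>" if \<beta>: "\<beta> \<in> elts \<kappa>" for \<beta>
  proof -
    have "\<exists>\<gamma> \<in> elts \<kappa>. g ` elts \<delta> \<subseteq> elts \<gamma>" if "\<delta> \<in> elts \<kappa>" for \<delta>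
      using bounded_elem[OF that, of g] g trans[OF that] by blast
    \<comment> \<open>\<open>h \<delta>\<close> bounds all values of \<open>g\<close> below
      \<delta>, so an element of \<open>S n\<close> is sent by \<open>g\<close> into
      \<open>S (Suc n)\<close>. This closes the supremum whether or not \<open>S\<close>
      increases.\<close>
    then obtain h where h: "\<And>\<delta>. \<delta> \<in> elts \<kappa> \<Longrightarrow> h \<delta> \<in> elts \<kappa>"
      "\<And>\<delta>. \<delta> \<in> elts \<kappa> \<Longrightarrow> g ` elts \<delta> \<subseteq> elts (h \<delta>)" by metis
    \<comment> \<open>The iteration starts at the successor of \<beta> to make \<beta> an element of
      the supremum.\<close>
    obtain s where s: "s \<in> elts \<kappa>" "elts s = insert \<beta> (elts \<beta>)" using \<beta> by (rule ex_succ)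
    define S where "S n = (h ^^ n) s" for n
    have S: "S n \<in> elts \<kappa>" for n
      by (induction n) (auto simp: S_def s h)
    obtain \<gamma> where \<gamma>: "\<gamma> \<in> elts \<kappa>" "range S \<subseteq> elts \<gamma>"
      using bounded[OF small_countable, of UNIV S] S by auto
    obtain \<delta> where \<delta>: "ordinal \<delta>" "elts \<delta> = (\<Union>a \<in> range S. elts a)" "elts \<delta> \<subseteq> elts \<gamma>"
      using ordinal_elem[OF \<gamma>(1)] \<gamma>(2) by (rule ordinal_sup)
    have "\<delta> \<in> elts \<kappa>" using ordinal_subset_mem[OF ordinal \<delta>(1,3) \<gamma>(1)] .
    moreover have "g x \<in> elts \<delta>" if x: "x \<in> elts \<delta>" for x
    proof -
      obtain n where "x \<in> elts (S n)" using x \<delta>(2) by blast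
      then have "g x \<in> elts (S (Suc n))" using h(2)[OF S[of n]] by (auto simp: S_def)
      then show ?thesis using \<delta>(2) by blast
    qed
    moreover have "\<beta> \<in> elts \<delta>"
    proof -
      have "\<beta> \<in> elts (S 0)" using s by (simp add: S_def)
      then show ?thesis using \<delta>(2) by blast
    qed
    ultimately show ?thesis by blast
  qed
  ultimately show ?thesis unfolding club_def unbounded_in_def mem_iff_elts by blast
qed

end

section \<open>Inaccessible cardinals as heights of universes\<close>

text \<open>The third clause is infinity in the guise of a nonempty set without a maximal element
  under membership. In the last clause the bound is transitive so that its ordinals form an ordinal,
  and it contains \<open>a\<close> so that a coding of \<open>f\<close> may neglect values in
  \<open>a\<close>.\<close>

definition universe_like :: "'v::zfc_universe set \<Rightarrow> bool" where
  "universe_like Y \<longleftrightarrow>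
     (\<forall>x \<in> Y. elts x \<subseteq> Y) \<and>
     (\<forall>x \<in> Y. \<exists>p \<in> Y. \<forall>z. elts z \<subseteq> elts x \<longrightarrow> z \<in> elts p) \<and>
     (\<exists>x \<in> Y. elts x \<noteq> {} \<and> (\<forall>y \<in> elts x. \<exists>z \<in> elts x. y \<in> elts z)) \<and>
     (\<forall>a \<in> Y. \<forall>f. f ` elts a \<subseteq> Y \<longrightarrow> (\<exists>s \<in> Y. transitive_set s \<and> elts a \<union> f ` elts a \<subseteq> elts s))"

lemma (in inacc) universe_like_Vset: "universe_like (Vset \<kappa>)"
  unfolding universe_like_def
proof (intro conjI ballI allI impI)
  fix x assume x: "x \<in> Vset \<kappa>"
  show "elts x \<subseteq> Vset \<kappa>" by (rule Vset_trans[OF ordinal x])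
  have "{z. elts z \<subseteq> elts x} \<lesssim> Pow (elts x)"
    unfolding lepoll_def by (intro exI[of _ elts]) (auto simp: inj_on_def elts_inject)
  then have sm: "small \<kappa> {z. elts z \<subseteq> elts x}"
    using small_Pow[OF small_elts[OF x]] small_lepoll by blast
  then obtain p where p: "elts p = {z. elts z \<subseteq> elts x}" by (rule small_imp_set)
  have "p \<in> Vset \<kappa>"
    using small_in_Vset[of p] sm Vset_subset[OF x] unfolding p by blast
  then show "\<exists>p \<in> Vset \<kappa>. \<forall>z. elts z \<subseteq> elts x \<longrightarrow> z \<in> elts p"
    using p by blast
next
  \<comment> \<open>The witness for infinity is the least infinite ordinal: its elements are finite,
    so it is closed under successor.\<close>
  obtain \<alpha> where "\<alpha> \<in> elts \<kappa>" "infinite (elts \<alpha>)" using ex_infinite by blast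
  then obtain \<mu> where \<mu>: "ordinal \<mu>" "\<mu> \<in> elts \<kappa> \<and> infinite (elts \<mu>)"
    "\<And>\<beta>. \<beta> \<in> elts \<mu> \<Longrightarrow> \<not> (\<beta> \<in> elts \<kappa> \<and> infinite (elts \<beta>))"
    using ordinal_least[of \<alpha> "\<lambda>\<mu>. \<mu> \<in> elts \<kappa> \<and> infinite (elts \<mu>)"] ordinal_elem by metis
  show "\<exists>x \<in> Vset \<kappa>. elts x \<noteq> {} \<and> (\<forall>y \<in> elts x. \<exists>z \<in> elts x. y \<in> elts z)"
  proof (rule bexI[of _ \<mu>], intro conjI ballI)
    show "elts \<mu> \<noteq> {}" using \<mu>(2) by auto
    show "\<mu> \<in> Vset \<kappa>" using \<mu>(2) ordinal_in_Vset[OF ordinal] by blast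
    fix y assume y: "y \<in> elts \<mu>"
    then have y\<kappa>: "y \<in> elts \<kappa>" using \<mu>(2) trans by blast
    then have "finite (elts y)" using \<mu>(3)[OF y] by blast
    obtain s where s: "s \<in> elts \<kappa>" "elts s = insert y (elts y)" using y\<kappa> by (rule ex_succ)
    have "elts s \<subseteq> elts \<mu>" using y ordinal_trans[OF \<mu>(1) y] by (auto simp: s)
    then have "s \<in> elts \<mu> \<or> s = \<mu>"
      using ordinal_subset_iff[OF ordinal_elem[OF s(1)] \<mu>(1)] by blast
    moreover have "s \<noteq> \<mu>" using \<mu>(2) s(2) \<open>finite (elts y)\<close> by auto
    ultimately show "\<exists>z \<in> elts \<mu>. y \<in> elts z" using s(2) by blast
  qed
next
  fix a f assume a: "a \<in> Vset \<kappa>" "f ` elts a \<subseteq> Vset \<kappa>"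
  have "small \<kappa> (elts a \<union> f ` elts a)"
    by (intro small_Un small_image small_elts a(1))
  then obtain \<beta> where \<beta>: "\<beta> \<in> elts \<kappa>" "elts a \<union> f ` elts a \<subseteq> Vset \<beta>"
    using small_subset_Vset[of "elts a \<union> f ` elts a"] a Vset_trans[OF ordinal] by (metis Un_least)
  obtain s where "s \<in> Vset \<kappa>" "elts s = Vset \<beta>" "transitive_set s"
    using \<beta>(1) by (rule ex_elts_Vset)
  then show "\<exists>s \<in> Vset \<kappa>. transitive_set s \<and> elts a \<union> f ` elts a \<subseteq> elts s"
    using \<beta>(2) by blast
qed

text \<open>On a finite set the converse of the well-founded membership relation is well-founded
  too, which would give a maximal element.\<close>

lemma no_max_imp_infinite:
  assumes "elts x \<noteq> {}" "\<forall>y \<in> elts x. \<exists>z \<in> elts x. y \<in> elts z"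
  shows "infinite (elts x)"
proof
  assume fin: "finite (elts x)"
  define r where "r = {(z, y). y \<in> elts x \<and> z \<in> elts x \<and> y \<in> elts z}"
  have "wf (r\<inverse>)"
  proof (rule wfI_min)
    fix q :: 'a and Q assume q: "q \<in> Q"
    show "\<exists>z \<in> Q. \<forall>y. (y, z) \<in> r\<inverse> \<longrightarrow> y \<notin> Q"
    proof (cases "Q \<inter> elts x = {}")
      case True
      then show ?thesis using q by (auto simp: r_def)
    next
      case False
      then obtain y where "y \<in> Q \<inter> elts x" "elts y \<inter> (Q \<inter> elts x) = {}"
        using ex_mem_minimal[of "Q \<inter> elts x" x] by blast
      then show ?thesis by (auto simp: r_def)
    qed
  qed
  moreover have "finite (r\<inverse>)"
    by (rule finite_subset[of _ "elts x \<times> elts x"]) (use fin in \<open>auto simp: r_def\<close>)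
  ultimately have "wf r"
    using wf_acyclic[of "r\<inverse>"] finite_acyclic_wf_converse[of "r\<inverse>"] by simp
  then obtain z where "z \<in> elts x" "\<forall>y. (y, z) \<in> r \<longrightarrow> y \<notin> elts x"
    using assms(1) wfE_min'[of r "elts x"] by blast
  then obtain w where "w \<in> elts x" "(w, z) \<in> r" using assms(2) unfolding r_def by blast
  with \<open>\<forall>y. (y, z) \<in> r \<longrightarrow> y \<notin> elts x\<close> show False by blast
qed

lemma universe_like_height_inaccessible:
  fixes \<mu> :: "'v::zfc_universe"
  assumes Y: "universe_like Y" and \<mu>: "elts \<mu> = {x \<in> Y. ordinal x}"
  shows "inaccessible \<mu>"
proof -
  have tr: "\<And>x. x \<in> Y \<Longrightarrow> elts x \<subseteq> Y"
    and pow: "\<And>x. x \<in> Y \<Longrightarrow> \<exists>p \<in> Y. \<forall>z. elts z \<subseteq> elts x \<longrightarrow> z \<in> elts p"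
    and inf: "\<exists>x \<in> Y. elts x \<noteq> {} \<and> (\<forall>y \<in> elts x. \<exists>z \<in> elts x. y \<in> elts z)"
    and repl: "\<And>a f. a \<in> Y \<Longrightarrow> f ` elts a \<subseteq> Y \<Longrightarrow>
      \<exists>s \<in> Y. transitive_set s \<and> elts a \<union> f ` elts a \<subseteq> elts s"
    using Y unfolding universe_like_def by blast+
  have sub: "y \<in> Y" if "x \<in> Y" "elts y \<subseteq> elts x" for x y
    using pow[OF that(1)] tr that(2) by blast
  have "transitive_set \<mu>"
    unfolding transitive_set_def \<mu> using tr ordinal_elem by blast
  then have ord: "ordinal \<mu>"
    using \<mu> by (auto simp: ordinal_def)
  have bdd: "\<exists>\<beta> \<in> elts \<mu>. f ` elts a \<subseteq> elts \<beta>" if a: "a \<in> Y" "f ` elts a \<subseteq> elts \<mu>" for a f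
  proof -
    obtain s where s: "s \<in> Y" "transitive_set s" "f ` elts a \<subseteq> elts s"
      using repl[of a f] a \<mu> by blast
    have "{x \<in> elts s. ordinal x} \<subseteq> elts s" by blast
    \<comment> \<open>The ordinals of the transitive bound \<open>s\<close> form an ordinal that is
      a subset of \<open>s\<close>, hence lies in \<open>Y\<close> and therefore below
      \<mu>.\<close>
    then obtain \<beta> where \<beta>: "elts \<beta> = {x \<in> elts s. ordinal x}" by (rule ex_elts_subset)
    have "ordinal \<beta>" using s(2) \<beta> by (rule ordinal_ordinals)
    moreover have "\<beta> \<in> Y" using sub[OF s(1), of \<beta>] \<beta> by blast
    ultimately have "\<beta> \<in> elts \<mu>" using \<mu> by blast
    moreover have "f ` elts a \<subseteq> elts \<beta>" using s(3) a(2) \<mu> \<beta> by blast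
    ultimately show ?thesis by blast
  qed
  \<comment> \<open>A bound \<beta> < \<mu> for all of \<mu> would be an element of itself.\<close>
  have not_onto: "f ` elts a \<noteq> elts \<mu>" if a: "a \<in> Y" for a f
    using bdd[OF a, of f] not_mem_self by blast
  have zero: "elts \<mu> \<noteq> {}"
  proof -
    obtain x where x: "x \<in> Y" using inf by blast
    obtain z :: 'v where z: "elts z = {}" by (rule ex_elts_subset[OF empty_subsetI[of "elts x"]])
    then have "z \<in> Y" "ordinal z"
      using sub[OF x, of z] by (auto simp: ordinal_def transitive_set_def)
    then show ?thesis using \<mu> by blast
  qed
  have not_lepoll: "\<not> elts \<mu> \<lesssim> elts a" if a: "a \<in> Y" for a
  proof
    assume "elts \<mu> \<lesssim> elts a"
    then obtain g where g: "inj_on g (elts \<mu>)" "g ` elts \<mu> \<subseteq> elts a" unfolding lepoll_def by blast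
    obtain z where z: "z \<in> elts \<mu>" using zero by blast
    have "(\<lambda>y. if y \<in> g ` elts \<mu> then the_inv_into (elts \<mu>) g y else z) ` elts a = elts \<mu>"
      (is "?h ` _ = _")
    proof
      show "?h ` elts a \<subseteq> elts \<mu>"
        using z the_inv_into_into[OF g(1) _ subset_refl] by auto
      have "x = ?h (g x)" if "x \<in> elts \<mu>" for x
        using that g(1) by (simp add: the_inv_into_f_f)
      then show "elts \<mu> \<subseteq> ?h ` elts a" using g(2) by blast
    qed
    then show False using not_onto[OF a] by blast
  qed
  have in_Y: "\<alpha> \<in> Y" if "\<alpha> \<in> elts \<mu>" for \<alpha> using that \<mu> by blast
  have card: "cardinal \<mu>"
    unfolding cardinal_def
    using ord not_lepoll[OF in_Y] eqpoll_imp_lepoll eqpoll_sym by blast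
  have unc: "uncountable (elts \<mu>)"
  proof
    assume "countable (elts \<mu>)"
    moreover obtain x where "x \<in> Y" "infinite (elts x)"
      using inf no_max_imp_infinite by blast
    ultimately show False
      using not_lepoll infinite_set_imp_countable_lepoll by blast
  qed
  \<comment> \<open>Every HOL subset of \<alpha> is a set, so the powerset of \<alpha> embeds into a
    member \<open>p\<close> of \<open>Y\<close>, and \<mu> does not embed there.\<close>
  have "strong_limit \<mu>"
    unfolding strong_limit_def
  proof (intro conjI ballI card)
    fix \<alpha> assume \<alpha>: "\<alpha> \<in> elts \<mu>"
    then obtain p where p: "p \<in> Y" "\<forall>z. elts z \<subseteq> elts \<alpha> \<longrightarrow> z \<in> elts p"
      using pow in_Y by blast
    have "Pow (elts \<alpha>) \<subseteq> elts ` elts p"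
    proof
      fix A assume "A \<in> Pow (elts \<alpha>)"
      then have "A \<subseteq> elts \<alpha>" by simp
      then obtain z where "elts z = A" by (rule ex_elts_subset)
      then show "A \<in> elts ` elts p" using p(2) \<open>A \<subseteq> elts \<alpha>\<close> by blast
    qed
    then have "Pow (elts \<alpha>) \<lesssim> elts p"
      by (rule lepoll_trans[OF subset_imp_lepoll image_lepoll])
    then have "\<not> elts \<mu> \<lesssim> Pow (elts \<alpha>)"
      using not_lepoll[OF p(1)] lepoll_trans[of "elts \<mu>" "Pow (elts \<alpha>)" "elts p"] by blast
    then show "Pow (elts \<alpha>) \<prec> elts \<mu>"
      using lepoll_linear[of "elts \<mu>" "Pow (elts \<alpha>)"]
        eqpoll_imp_lepoll[OF eqpoll_sym, of "Pow (elts \<alpha>)" "elts \<mu>"]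
      unfolding lesspoll_def by blast
  qed
  moreover have "regular \<mu>"
    unfolding regular_def using card unc bdd in_Y countable_finite by blast
  ultimately show ?thesis using unc by (simp add: inaccessible_def)
qed

text \<open>
  A function on \<open>a\<close> is coded by unordered pairs, which is unambiguous on the part of
  its range that lies outside \<open>a\<close>; the rest of the range is bounded by \<open>a\<close> itself.
\<close>

definition codes_onto :: "'v::zfc_universe \<Rightarrow> 'v set \<Rightarrow> 'v set \<Rightarrow> bool" where
  "codes_onto a F Z \<longleftrightarrow> Z \<inter> elts a = {} \<and>
     (\<forall>y \<in> Z. \<exists>u \<in> elts a. \<exists>p \<in> F. elts p = {u, y}) \<and>
     (\<forall>u \<in> elts a. \<forall>y \<in> Z. \<forall>y' \<in> Z.
        (\<exists>p \<in> F. elts p = {u, y}) \<and> (\<exists>p \<in> F. elts p = {u, y'}) \<longrightarrow> y = y')"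

text \<open>From a code, choice extracts a function with range covering \<open>Z\<close>. From a
  function, the pairs {u, f u} form \<open>F\<close> and the range outside \<open>a\<close> forms
  \<open>Z\<close>; the rest of the range is covered by the bound anyway.\<close>

lemma (in inacc) replacement_coded:
  assumes Y: "Y \<subseteq> Vset \<kappa>" "\<And>x. x \<in> Y \<Longrightarrow> elts x \<subseteq> Y" and a: "a \<in> Y"
  shows "(\<forall>f. f ` elts a \<subseteq> Y \<longrightarrow> (\<exists>s \<in> Y. transitive_set s \<and> elts a \<union> f ` elts a \<subseteq> elts s)) \<longleftrightarrow>
    (\<forall>F \<subseteq> Vset \<kappa>. \<forall>Z \<subseteq> Y. codes_onto a F Z \<longrightarrow>
       (\<exists>s \<in> Y. transitive_set s \<and> elts a \<union> Z \<subseteq> elts s))" (is "?L \<longleftrightarrow> ?R")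
proof
  assume L: ?L
  show ?R
  proof (intro allI impI)
    fix F Z assume F: "F \<subseteq> Vset \<kappa>" and Z: "Z \<subseteq> Y" "codes_onto a F Z"
    define R where "R u y \<longleftrightarrow> y \<in> Z \<and> (\<exists>p \<in> F. elts p = {u, y})" for u y
    \<comment> \<open>Arguments without a coded value are fixed, which keeps \<open>f\<close> inside
      \<open>Y\<close> because \<open>Y\<close> is transitive.\<close>
    define f where "f u = (if \<exists>y. R u y then SOME y. R u y else u)" for u
    have f_R: "R u (f u)" if "R u y" for u y
      using that someI[of "R u"] by (auto simp: f_def)
    have "f ` elts a \<subseteq> Y"
    proof
      fix y assume "y \<in> f ` elts a"
      then obtain u where u: "u \<in> elts a" "y = f u" by blast
      show "y \<in> Y"
      proof (cases "\<exists>y. R u y")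
        case True
        then show ?thesis using f_R[of u] u Z(1) by (auto simp: R_def)
      next
        case False
        then have "y = u" unfolding u(2) f_def by (rule if_not_P)
        then show ?thesis using Y(2)[OF a] u by blast
      qed
    qed
    then obtain s where s: "s \<in> Y" "transitive_set s" "elts a \<union> f ` elts a \<subseteq> elts s"
      using L by blast
    have "Z \<subseteq> f ` elts a"
    proof
      fix y assume y: "y \<in> Z"
      then obtain u where u: "u \<in> elts a" "R u y" using Z(2) unfolding codes_onto_def R_def by blast
      then have "R u (f u)" by (intro f_R)
      then have "f u = y" using u y Z(2) unfolding codes_onto_def R_def by blast
      then show "y \<in> f ` elts a" using u by blast
    qed
    then show "\<exists>s \<in> Y. transitive_set s \<and> elts a \<union> Z \<subseteq> elts s" using s by blast
  qed
next
  assume R: ?R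
  show ?L
  proof (intro allI impI)
    fix f assume f: "f ` elts a \<subseteq> Y"
    define F where "F = {p. \<exists>u \<in> elts a. elts p = {u, f u}}"
    define Z where "Z = f ` elts a - elts a"
    have "F \<subseteq> Vset \<kappa>"
      unfolding F_def using Vset_pair f Y a by blast
    moreover have "Z \<subseteq> Y" using f by (auto simp: Z_def)
    moreover have "codes_onto a F Z"
      unfolding codes_onto_def
    proof (intro conjI ballI impI)
      show "Z \<inter> elts a = {}" by (auto simp: Z_def)
      fix y assume "y \<in> Z"
      then obtain u where u: "u \<in> elts a" "y = f u" by (auto simp: Z_def)
      obtain p where "elts p = {u, y}" by (rule ex_elts_pair)
      then show "\<exists>u \<in> elts a. \<exists>p \<in> F. elts p = {u, y}" using u by (auto simp: F_def)
    next
      fix u y y'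
      assume *: "u \<in> elts a" "y \<in> Z" "y' \<in> Z"
        "(\<exists>p \<in> F. elts p = {u, y}) \<and> (\<exists>p \<in> F. elts p = {u, y'})"
      \<comment> \<open>From {u, y} = {v, f v} with \<open>v\<close> in \<open>a\<close> and
        \<open>y\<close> outside \<open>a\<close> it follows that \<open>y\<close> is not
        \<open>v\<close>, so \<open>u = v\<close> and \<open>y = f v\<close>.\<close>
      have "y = f u" if "y \<in> Z" "\<exists>p \<in> F. elts p = {u, y}" for y
        using that \<open>u \<in> elts a\<close> by (auto simp: F_def Z_def doubleton_eq_iff)
      then show "y = y'" using * by metis
    qed
    ultimately obtain s where "s \<in> Y" "transitive_set s" "elts a \<union> Z \<subseteq> elts s"
      using R by blast
    then show "\<exists>s \<in> Y. transitive_set s \<and> elts a \<union> f ` elts a \<subseteq> elts s"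
      by (auto simp: Z_def intro!: bexI[of _ s])
  qed
qed

text \<open>The right-hand side quantifies only over elements and subsets of V_\<kappa>, so it can
  be written as a formula. The witness for an inaccessible \<mu> is V_\<mu>.\<close>

lemma (in inacc) inaccessible_elem_iff:
  assumes "\<mu> \<in> elts \<kappa>"
  shows "inaccessible \<mu> \<longleftrightarrow>
    (\<exists>Y \<subseteq> Vset \<kappa>. universe_like Y \<and> (\<forall>x \<in> Vset \<kappa>. x \<in> elts \<mu> \<longleftrightarrow> x \<in> Y \<and> ordinal x))"
    (is "_ \<longleftrightarrow> ?R")
proof
  assume "inaccessible \<mu>"
  then interpret \<mu>: inacc \<mu> by unfold_locales
  have sub: "Vset \<mu> \<subseteq> Vset \<kappa>" using assms Vset_mono_elem[OF ordinal] by blast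
  then show ?R
    using \<mu>.universe_like_Vset Vset_ordinals[OF \<mu>.ordinal] by (intro exI[of _ "Vset \<mu>"]) auto
next
  assume ?R
  then obtain Y where Y: "Y \<subseteq> Vset \<kappa>" "universe_like Y"
    "\<forall>x \<in> Vset \<kappa>. x \<in> elts \<mu> \<longleftrightarrow> x \<in> Y \<and> ordinal x" by blast
  have "elts \<mu> \<subseteq> Vset \<kappa>"
    using Vset_trans[OF ordinal ordinal_in_Vset[OF ordinal assms]] .
  then have "elts \<mu> = {x \<in> Y. ordinal x}" using Y(1,3) by blast
  then show "inaccessible \<mu>" by (rule universe_like_height_inaccessible[OF Y(2)])
qed

section \<open>Elementary initial segments of a Mahlo universe\<close>

instance fm :: countable
  by countable_datatype

lemma sat_first_order_cong: "first_order \<phi> \<Longrightarrow> sat M e E \<phi> \<longleftrightarrow> sat M e E' \<phi>"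
  by (induction \<phi> arbitrary: e) auto

text \<open>Assignments give values to all variables, so whole sequences have to be counted; their
  graphs are subsets of a small product.\<close>

lemma (in inacc) small_sequences:
  assumes "small \<kappa> A" shows "small \<kappa> {e :: nat \<Rightarrow> 'a. range e \<subseteq> A}"
proof -
  have "{e :: nat \<Rightarrow> 'a. range e \<subseteq> A} \<lesssim> Pow ((UNIV :: nat set) \<times> A)"
    unfolding lepoll_def
    by (intro exI[of _ "\<lambda>e. range (\<lambda>n. (n, e n))"]) (auto simp: inj_on_def fun_eq_iff set_eq_iff image_iff)
  then show ?thesis
    by (rule small_lepoll[OF small_Pow[OF small_Times[OF small_countable[OF countableI_type] assms]]])
qed

text \<open>The Tarski-Vaught test, with \<mu> an inaccessible closure point of a function bounding
  Skolem witnesses.\<close>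

lemma Mahlo_elementary_Vset:
  fixes \<kappa> :: "'v::zfc_universe"
  assumes "Mahlo \<kappa>"
  obtains \<mu> where "\<mu> \<in> elts \<kappa>" "inaccessible \<mu>" "Vset \<mu> \<subseteq> Vset \<kappa>"
    "\<And>\<phi> e E. first_order \<phi> \<Longrightarrow> range e \<subseteq> Vset \<mu> \<Longrightarrow> sat (Vset \<mu>) e E \<phi> \<longleftrightarrow> sat (Vset \<kappa>) e E \<phi>"
proof -
  interpret inacc \<kappa> using assms by unfold_locales (simp add: Mahlo_def)
  define S where "S e n \<phi> x \<longleftrightarrow> sat (Vset \<kappa>) (e(n := x)) (\<lambda>_. {}) \<phi>" for e n \<phi> x
  have "\<exists>\<gamma> \<in> elts \<kappa>. \<forall>e n \<phi>. range e \<subseteq> Vset \<alpha> \<longrightarrow> (\<exists>x \<in> Vset \<kappa>. S e n \<phi> x) \<longrightarrow> (\<exists>x \<in> Vset \<gamma>. S e n \<phi> x)"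
    if \<alpha>: "\<alpha> \<in> elts \<kappa>" for \<alpha>
  proof -
    \<comment> \<open>One request per assignment into V_\<alpha>, variable and formula. Formulas are
      countable, so the requests form a small set and one \<gamma> < \<kappa> bounds a witness for
      each satisfiable request.\<close>
    let ?A = "{e :: nat \<Rightarrow> 'v. range e \<subseteq> Vset \<alpha>} \<times> (UNIV :: (nat \<times> fm) set)"
    let ?A' = "{t \<in> ?A. case t of (e, n, \<phi>) \<Rightarrow> \<exists>x \<in> Vset \<kappa>. S e n \<phi> x}"
    let ?w = "\<lambda>(e, n, \<phi>). SOME x. x \<in> Vset \<kappa> \<and> S e n \<phi> x"
    have w: "?w t \<in> Vset \<kappa> \<and> (case t of (e, n, \<phi>) \<Rightarrow> S e n \<phi> (?w t))" if "t \<in> ?A'" for t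
    proof -
      obtain e n \<phi> where t: "t = (e, n, \<phi>)" by (cases t) auto
      have "\<exists>x. x \<in> Vset \<kappa> \<and> S e n \<phi> x" using that by (auto simp: t)
      from someI_ex[OF this] show ?thesis by (simp add: t)
    qed
    have "small \<kappa> ?A"
      using small_Times[OF small_sequences[OF small_Vset[OF \<alpha>]] small_countable[OF countableI_type]] .
    then have "small \<kappa> ?A'" by (rule small_subset) blast
    then have "small \<kappa> (?w ` ?A')" by (rule small_image)
    moreover have "?w ` ?A' \<subseteq> Vset \<kappa>" using w by blast
    ultimately obtain \<gamma> where \<gamma>: "\<gamma> \<in> elts \<kappa>" "?w ` ?A' \<subseteq> Vset \<gamma>" by (rule small_subset_Vset)
    have "\<exists>x \<in> Vset \<gamma>. S e n \<phi> x" if "range e \<subseteq> Vset \<alpha>" "\<exists>x \<in> Vset \<kappa>. S e n \<phi> x" for e n \<phi>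
    proof -
      have t: "(e, n, \<phi>) \<in> ?A'" using that by simp
      then have "?w (e, n, \<phi>) \<in> Vset \<gamma>" using \<gamma>(2) by (rule image_subset_iff[THEN iffD1, rule_format, rotated])
      moreover have "S e n \<phi> (?w (e, n, \<phi>))" using w[OF t] by simp
      ultimately show ?thesis by blast
    qed
    then show ?thesis using \<gamma>(1) by blast
  qed
  then obtain g where g: "\<And>\<alpha>. \<alpha> \<in> elts \<kappa> \<Longrightarrow> g \<alpha> \<in> elts \<kappa>"
    "\<And>\<alpha> e n \<phi>. \<alpha> \<in> elts \<kappa> \<Longrightarrow> range e \<subseteq> Vset \<alpha> \<Longrightarrow> \<exists>x \<in> Vset \<kappa>. S e n \<phi> x \<Longrightarrow> \<exists>x \<in> Vset (g \<alpha>). S e n \<phi> x"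
    by metis
  have "club {\<alpha> \<in> elts \<kappa>. \<forall>\<beta> \<in> elts \<alpha>. g \<beta> \<in> elts \<alpha>} \<kappa>"
    by (rule closure_points_club[OF g(1)])
  then obtain \<mu> where \<mu>: "\<mu> \<in> elts \<kappa>" "inaccessible \<mu>" "\<And>\<beta>. \<beta> \<in> elts \<mu> \<Longrightarrow> g \<beta> \<in> elts \<mu>"
    using assms unfolding Mahlo_def stationary_def by blast
  interpret \<mu>: inacc \<mu> using \<mu>(2) by unfold_locales
  have sub: "Vset \<mu> \<subseteq> Vset \<kappa>" by (rule Vset_mono_elem[OF ordinal \<mu>(1)])
  have witness: "\<exists>x \<in> Vset \<mu>. S e n \<phi> x" if e: "range e \<subseteq> Vset \<mu>" "\<exists>x \<in> Vset \<kappa>. S e n \<phi> x" for e n \<phi>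
  proof -
    \<comment> \<open>Countable sets are small for \<mu>, so the assignment already lives in some
      V_\<beta> with \<beta> < \<mu>, where closure under \<open>g\<close> applies.\<close>
    have "small \<mu> (range e)" by (rule \<mu>.small_countable) simp
    then obtain \<beta> where \<beta>: "\<beta> \<in> elts \<mu>" "range e \<subseteq> Vset \<beta>" using e(1) by (rule \<mu>.small_subset_Vset)
    then have "\<exists>x \<in> Vset (g \<beta>). S e n \<phi> x" using g(2) e(2) trans[OF \<mu>(1)] by blast
    then show ?thesis using Vset_mono_elem[OF \<mu>.ordinal \<mu>(3)[OF \<beta>(1)]] by blast
  qed
  have elem: "sat (Vset \<mu>) e (\<lambda>_. {}) \<phi> \<longleftrightarrow> sat (Vset \<kappa>) e (\<lambda>_. {}) \<phi>"
    if "first_order \<phi>" "range e \<subseteq> Vset \<mu>" for e \<phi>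
    using that
  proof (induction \<phi> arbitrary: e)
    case (Forall n \<phi>)
    have upd: "range (e(n := x)) \<subseteq> Vset \<mu>" if "x \<in> Vset \<mu>" for x
      using Forall.prems(2) that by auto
    have IH: "sat (Vset \<mu>) (e(n := x)) (\<lambda>_. {}) \<phi> \<longleftrightarrow> sat (Vset \<kappa>) (e(n := x)) (\<lambda>_. {}) \<phi>"
      if "x \<in> Vset \<mu>" for x
      by (rule Forall.IH[OF _ upd[OF that]]) (use Forall.prems(1) in simp)
    \<comment> \<open>A failing universal formula is a request for a witness of the
      negation.\<close>
    have "(\<exists>x \<in> Vset \<kappa>. S e n (Neg \<phi>) x) \<longleftrightarrow> (\<exists>x \<in> Vset \<mu>. S e n (Neg \<phi>) x)"
      using witness[OF Forall.prems(2)] sub by blast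
    then show ?case using IH by (auto simp: S_def)
  qed auto
  have "sat (Vset \<mu>) e E \<phi> \<longleftrightarrow> sat (Vset \<kappa>) e E \<phi>" if "first_order \<phi>" "range e \<subseteq> Vset \<mu>" for e E \<phi>
    using elem[OF that] sat_first_order_cong[OF that(1), of _ e E] by blast
  then show ?thesis using that \<mu>(1,2) sub by blast
qed

lemma Mahlo_not_first_order_theory_categorical:
  assumes "Mahlo \<kappa>" shows "\<not> first_order_theory_categorical \<kappa>"
proof
  assume "first_order_theory_categorical \<kappa>"
  then obtain T where T: "first_order_theory T" "models_theory (Vset \<kappa>) T"
    "\<And>\<mu>. inaccessible \<mu> \<Longrightarrow> \<mu> \<noteq> \<kappa> \<Longrightarrow> \<not> models_theory (Vset \<mu>) T"
    unfolding first_order_theory_categorical_def by blast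
  obtain \<mu> where \<mu>: "\<mu> \<in> elts \<kappa>" "inaccessible \<mu>" "Vset \<mu> \<subseteq> Vset \<kappa>"
    "\<And>\<phi> e E. first_order \<phi> \<Longrightarrow> range e \<subseteq> Vset \<mu> \<Longrightarrow> sat (Vset \<mu>) e E \<phi> \<longleftrightarrow> sat (Vset \<kappa>) e E \<phi>"
    using Mahlo_elementary_Vset[OF assms] by blast
  have "Vset \<mu> \<Turnstile> \<phi>" if "\<phi> \<in> T" for \<phi>
  proof -
    have "first_order \<phi>" "Vset \<kappa> \<Turnstile> \<phi>"
      using that T(1,2) by (auto simp: first_order_theory_def models_theory_def)
    then show ?thesis unfolding models_def using \<mu>(3,4) by (meson subset_trans)
  qed
  then have "models_theory (Vset \<mu>) T" by (simp add: models_theory_def)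
  moreover have "\<mu> \<noteq> \<kappa>" using \<mu>(1) not_mem_self by blast
  ultimately show False using T(3) \<mu>(2) by blast
qed

section \<open>A second-order sentence for the least Mahlo cardinal\<close>

definition "Imp \<phi> \<psi> = Neg (Conj \<phi> (Neg \<psi>))"
definition "Disj \<phi> \<psi> = Neg (Conj (Neg \<phi>) (Neg \<psi>))"
definition "Iff \<phi> \<psi> = Conj (Imp \<phi> \<psi>) (Imp \<psi> \<phi>)"
definition "Exists n \<phi> = Neg (Forall n (Neg \<phi>))"
definition "ExistsSet n \<phi> = Neg (ForallSet n (Neg \<phi>))"

lemmas connective_defs = Imp_def Disj_def Iff_def Exists_def ExistsSet_def

lemma sat_connectives [simp]:
  "sat M e E (Imp \<phi> \<psi>) \<longleftrightarrow> (sat M e E \<phi> \<longrightarrow> sat M e E \<psi>)"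
  "sat M e E (Disj \<phi> \<psi>) \<longleftrightarrow> sat M e E \<phi> \<or> sat M e E \<psi>"
  "sat M e E (Iff \<phi> \<psi>) \<longleftrightarrow> (sat M e E \<phi> \<longleftrightarrow> sat M e E \<psi>)"
  "sat M e E (Exists n \<phi>) \<longleftrightarrow> (\<exists>x \<in> M. sat M (e(n := x)) E \<phi>)"
  "sat M e E (ExistsSet n \<phi>) \<longleftrightarrow> (\<exists>X \<subseteq> M. sat M e (E(n := X)) \<phi>)"
  by (auto simp: connective_defs)

text \<open>
  Bound variables are chosen so that no substitution captures: the first-order variables from 100
  on belong to the basic predicates, and each later formula uses its own block of indices.
\<close>

definition transitive_fm :: "nat \<Rightarrow> fm" where
  "transitive_fm i =
     Forall 100 (Imp (Mem 100 i) (Forall 101 (Imp (Mem 101 100) (Mem 101 i))))"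

definition ordinal_fm :: "nat \<Rightarrow> fm" where
  "ordinal_fm i = Conj (transitive_fm i) (Forall 102 (Imp (Mem 102 i) (transitive_fm 102)))"

definition pair_in_fm :: "nat \<Rightarrow> nat \<Rightarrow> nat \<Rightarrow> fm" where
  "pair_in_fm F u y =
     Exists 100 (Conj (InSet 100 F) (Forall 101 (Iff (Mem 101 100) (Disj (Eq 101 u) (Eq 101 y)))))"

definition codes_onto_fm :: "nat \<Rightarrow> nat \<Rightarrow> nat \<Rightarrow> fm" where
  "codes_onto_fm a F Z =
     Conj (Forall 10 (Imp (InSet 10 Z)
            (Conj (Neg (Mem 10 a)) (Exists 11 (Conj (Mem 11 a) (pair_in_fm F 11 10))))))
       (Forall 11 (Imp (Mem 11 a) (Forall 10 (Imp (InSet 10 Z) (Forall 12 (Imp (InSet 12 Z)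
            (Imp (Conj (pair_in_fm F 11 10) (pair_in_fm F 11 12)) (Eq 10 12))))))))"

definition replacement_fm :: "nat \<Rightarrow> nat \<Rightarrow> fm" where
  "replacement_fm a Y =
     ForallSet 10 (ForallSet 11 (Imp (Forall 13 (Imp (InSet 13 11) (InSet 13 Y)))
       (Imp (codes_onto_fm a 10 11)
         (Exists 13 (Conj (InSet 13 Y) (Conj (transitive_fm 13)
           (Forall 14 (Imp (Disj (Mem 14 a) (InSet 14 11)) (Mem 14 13)))))))))"

definition universe_like_fm :: "nat \<Rightarrow> fm" where
  "universe_like_fm Y =
     Conj (Forall 20 (Imp (InSet 20 Y) (Forall 21 (Imp (Mem 21 20) (InSet 21 Y)))))
    (Conj (Forall 20 (Imp (InSet 20 Y) (Exists 21 (Conj (InSet 21 Y)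
            (Forall 22 (Imp (Forall 23 (Imp (Mem 23 22) (Mem 23 20))) (Mem 22 21)))))))
    (Conj (Exists 20 (Conj (InSet 20 Y) (Conj (Exists 21 (Mem 21 20))
            (Forall 21 (Imp (Mem 21 20) (Exists 22 (Conj (Mem 22 20) (Mem 21 22))))))))
       (Forall 20 (Imp (InSet 20 Y) (replacement_fm 20 Y)))))"

definition inaccessible_fm :: "nat \<Rightarrow> fm" where
  "inaccessible_fm m =
     ExistsSet 0 (Conj (universe_like_fm 0)
       (Forall 30 (Iff (Mem 30 m) (Conj (InSet 30 0) (ordinal_fm 30)))))"

definition club_fm :: "nat \<Rightarrow> nat \<Rightarrow> fm" where
  "club_fm C K =
     Conj (Forall 40 (Imp (InSet 40 C) (InSet 40 K)))
    (Conj (Forall 40 (Imp (InSet 40 K) (Imp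
            (Conj (Exists 41 (Mem 41 40))
              (Forall 41 (Imp (Mem 41 40) (Exists 42 (Conj (InSet 42 C) (Conj (Mem 42 40) (Mem 41 42)))))))
            (InSet 40 C))))
       (Forall 40 (Imp (InSet 40 K) (Exists 41 (Conj (InSet 41 C) (Mem 40 41))))))"

text \<open>That the inaccessible lies in \<open>K\<close> is ensured by
  \<open>club_fm\<close>.\<close>

definition stationary_inaccessibles_fm :: "nat \<Rightarrow> fm" where
  "stationary_inaccessibles_fm K =
     ForallSet 1 (Imp (club_fm 1 K) (Exists 50 (Conj (InSet 50 1) (inaccessible_fm 50))))"

text \<open>Class variable 2 is forced to be the class of ordinals, that is \<kappa>, and class
  variable 3 the extension of a smaller \<mu>. Inaccessibility is asserted of \<mu> alone: for
  \<kappa> it is supplied by the heights among which categoricity compares.\<close>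

definition least_Mahlo_fm :: fm where
  "least_Mahlo_fm =
     ExistsSet 2 (Conj (Forall 60 (Iff (InSet 60 2) (ordinal_fm 60)))
       (Conj (stationary_inaccessibles_fm 2)
         (Forall 60 (Imp (Conj (InSet 60 2) (inaccessible_fm 60))
           (Neg (ExistsSet 3 (Conj (Forall 61 (Iff (InSet 61 3) (Mem 61 60)))
             (stationary_inaccessibles_fm 3))))))))"

lemma sentence_least_Mahlo_fm: "sentence least_Mahlo_fm"
  unfolding sentence_def least_Mahlo_fm_def stationary_inaccessibles_fm_def club_fm_def
    inaccessible_fm_def universe_like_fm_def replacement_fm_def codes_onto_fm_def pair_in_fm_def
    ordinal_fm_def transitive_fm_def connective_defs
  by auto

section \<open>Truth of the formulas in V_\<kappa>\<close>

context inacc begin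

lemma Vset_elts: "x \<in> Vset \<kappa> \<Longrightarrow> y \<in> elts x \<Longrightarrow> y \<in> Vset \<kappa>"
  using Vset_trans[OF ordinal] by blast

lemma ball_Vset_subset: "Y \<subseteq> Vset \<kappa> \<Longrightarrow> (\<forall>x \<in> Vset \<kappa>. x \<in> Y \<longrightarrow> P x) \<longleftrightarrow> (\<forall>x \<in> Y. P x)"
  and bex_Vset_subset: "Y \<subseteq> Vset \<kappa> \<Longrightarrow> (\<exists>x \<in> Vset \<kappa>. x \<in> Y \<and> P x) \<longleftrightarrow> (\<exists>x \<in> Y. P x)"
  by blast+

lemma ex_subset_Vset:
  assumes "A = {x \<in> Vset \<kappa>. Q x}"
  shows "(\<exists>X \<subseteq> Vset \<kappa>. (\<forall>x \<in> Vset \<kappa>. x \<in> X \<longleftrightarrow> Q x) \<and> P X) \<longleftrightarrow> P A"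
proof -
  have "X \<subseteq> Vset \<kappa> \<and> (\<forall>x \<in> Vset \<kappa>. x \<in> X \<longleftrightarrow> Q x) \<longleftrightarrow> X = A" for X
    using assms by blast
  then show ?thesis by (metis (no_types))
qed

text \<open>Absolute since V_\<kappa> is transitive. The index condition excludes just the bound
  variables, because \<open>ordinal_fm\<close> also applies the formula to variable 102.\<close>

lemma sat_transitive_fm:
  assumes "i \<notin> {100, 101}" "e i \<in> Vset \<kappa>"
  shows "sat (Vset \<kappa>) e E (transitive_fm i) \<longleftrightarrow> transitive_set (e i)"
proof -
  have "(\<forall>x \<in> Vset \<kappa>. x \<in> elts (e i) \<longrightarrow> (\<forall>y \<in> Vset \<kappa>. y \<in> elts x \<longrightarrow> y \<in> elts (e i))) \<longleftrightarrow>
      transitive_set (e i)"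
    unfolding transitive_set_def using Vset_elts assms(2) by blast
  then show ?thesis using assms(1) by (simp add: transitive_fm_def mem_iff_elts)
qed

lemma sat_ordinal_fm:
  assumes "i < 100" "e i \<in> Vset \<kappa>"
  shows "sat (Vset \<kappa>) e E (ordinal_fm i) \<longleftrightarrow> ordinal (e i)"
proof -
  have "(\<forall>x \<in> Vset \<kappa>. x \<in> elts (e i) \<longrightarrow> transitive_set x) \<longleftrightarrow> (\<forall>x \<in> elts (e i). transitive_set x)"
    using Vset_elts[OF assms(2)] by blast
  then show ?thesis
    using assms
    by (simp add: ordinal_fm_def ordinal_def mem_iff_elts sat_transitive_fm cong: ball_cong_simp)
qed

lemma sat_pair_in_fm:
  assumes "u < 100" "y < 100" "e u \<in> Vset \<kappa>" "e y \<in> Vset \<kappa>" "E F \<subseteq> Vset \<kappa>"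
  shows "sat (Vset \<kappa>) e E (pair_in_fm F u y) \<longleftrightarrow> (\<exists>p \<in> E F. elts p = {e u, e y})"
proof -
  have "(\<forall>z \<in> Vset \<kappa>. z \<in> elts p \<longleftrightarrow> z = e u \<or> z = e y) \<longleftrightarrow> elts p = {e u, e y}"
    if "p \<in> Vset \<kappa>" for p
    using that Vset_elts[OF that] assms(3,4) by blast
  then show ?thesis
    using assms by (auto simp: pair_in_fm_def mem_iff_elts)
qed

lemma sat_codes_onto_fm:
  assumes "a \<notin> {10, 11, 12}" "a < 100" "e a \<in> Vset \<kappa>" "E F \<subseteq> Vset \<kappa>" "E Z \<subseteq> Vset \<kappa>"
  shows "sat (Vset \<kappa>) e E (codes_onto_fm a F Z) \<longleftrightarrow> codes_onto (e a) (E F) (E Z)"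
proof -
  have "elts (e a) \<subseteq> Vset \<kappa>" using Vset_elts[OF assms(3)] by blast
  then show ?thesis
    using assms
    by (simp add: codes_onto_fm_def codes_onto_def mem_iff_elts sat_pair_in_fm
        ball_Vset_subset bex_Vset_subset subset_iff cong: ball_cong_simp bex_cong_simp conj_cong)
      blast
qed

lemma sat_replacement_fm:
  assumes "a \<notin> {10, 11, 12, 13, 14}" "a < 100" "Y \<notin> {10, 11}" "e a \<in> Vset \<kappa>" "E Y \<subseteq> Vset \<kappa>"
  shows "sat (Vset \<kappa>) e E (replacement_fm a Y) \<longleftrightarrow>
    (\<forall>F \<subseteq> Vset \<kappa>. \<forall>Z \<subseteq> E Y. codes_onto (e a) F Z \<longrightarrow>
      (\<exists>s \<in> E Y. transitive_set s \<and> elts (e a) \<union> Z \<subseteq> elts s))" (is "?L \<longleftrightarrow> ?R")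
proof -
  have "sat (Vset \<kappa>) e E (replacement_fm a Y) \<longleftrightarrow>
    (\<forall>F \<subseteq> Vset \<kappa>. \<forall>Z \<subseteq> Vset \<kappa>. (\<forall>x \<in> Vset \<kappa>. x \<in> Z \<longrightarrow> x \<in> E Y) \<longrightarrow> codes_onto (e a) F Z \<longrightarrow>
      (\<exists>s \<in> Vset \<kappa>. s \<in> E Y \<and> transitive_set s \<and>
        (\<forall>x \<in> Vset \<kappa>. x \<in> elts (e a) \<or> x \<in> Z \<longrightarrow> x \<in> elts s)))"
    using assms
    by (simp add: replacement_fm_def sat_codes_onto_fm sat_transitive_fm mem_iff_elts
        cong: bex_cong_simp)
  also have "\<dots> \<longleftrightarrow> ?R"
  proof -
    have "(\<forall>x \<in> Vset \<kappa>. x \<in> elts (e a) \<or> x \<in> Z \<longrightarrow> x \<in> elts s) \<longleftrightarrow> elts (e a) \<union> Z \<subseteq> elts s"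
      if "Z \<subseteq> Vset \<kappa>" for Z s
      using that Vset_elts[OF assms(4)] by blast
    then have "(\<exists>s \<in> Vset \<kappa>. s \<in> E Y \<and> transitive_set s \<and>
        (\<forall>x \<in> Vset \<kappa>. x \<in> elts (e a) \<or> x \<in> Z \<longrightarrow> x \<in> elts s)) \<longleftrightarrow>
      (\<exists>s \<in> E Y. transitive_set s \<and> elts (e a) \<union> Z \<subseteq> elts s)" if "Z \<subseteq> Vset \<kappa>" for Z
      using that assms(5) by blast
    moreover have "(\<forall>x \<in> Vset \<kappa>. x \<in> Z \<longrightarrow> x \<in> E Y) \<longleftrightarrow> Z \<subseteq> E Y" if "Z \<subseteq> Vset \<kappa>" for Z
      using that by blast
    ultimately show ?thesis
      using assms(5) by (smt (verit) subset_trans)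
  qed
  finally show ?thesis .
qed

lemma sat_universe_like_fm:
  assumes "Y < 10" "E Y \<subseteq> Vset \<kappa>"
  shows "sat (Vset \<kappa>) e E (universe_like_fm Y) \<longleftrightarrow> universe_like (E Y)"
proof -
  let ?M = "Vset \<kappa>" and ?Y = "E Y"
  have sub: "(\<forall>y \<in> ?M. y \<in> elts x \<longrightarrow> P y) \<longleftrightarrow> (\<forall>y \<in> elts x. P y)"
    "(\<exists>y \<in> ?M. y \<in> elts x \<and> P y) \<longleftrightarrow> (\<exists>y \<in> elts x. P y)"
    "(\<exists>y \<in> ?M. y \<in> elts x) \<longleftrightarrow> elts x \<noteq> {}" if "x \<in> ?M" for x P
    using Vset_elts[OF that] by blast+
  \<comment> \<open>Subsets of an element of V_\<kappa> are again in V_\<kappa>, so V_\<kappa>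
    computes powersets correctly.\<close>
  have pow: "(\<forall>z \<in> ?M. (\<forall>w \<in> ?M. w \<in> elts z \<longrightarrow> w \<in> elts x) \<longrightarrow> z \<in> elts p) \<longleftrightarrow>
      (\<forall>z. elts z \<subseteq> elts x \<longrightarrow> z \<in> elts p)" if "x \<in> ?M" for x p
    using Vset_subset[OF that] Vset_elts by blast
  have "sat ?M e E (universe_like_fm Y) \<longleftrightarrow>
     (\<forall>x \<in> ?M. x \<in> ?Y \<longrightarrow> (\<forall>y \<in> ?M. y \<in> elts x \<longrightarrow> y \<in> ?Y)) \<and>
     (\<forall>x \<in> ?M. x \<in> ?Y \<longrightarrow> (\<exists>p \<in> ?M. p \<in> ?Y \<and>
        (\<forall>z \<in> ?M. (\<forall>w \<in> ?M. w \<in> elts z \<longrightarrow> w \<in> elts x) \<longrightarrow> z \<in> elts p))) \<and>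
     (\<exists>x \<in> ?M. x \<in> ?Y \<and> (\<exists>y \<in> ?M. y \<in> elts x) \<and>
        (\<forall>y \<in> ?M. y \<in> elts x \<longrightarrow> (\<exists>z \<in> ?M. z \<in> elts x \<and> y \<in> elts z))) \<and>
     (\<forall>x \<in> ?M. x \<in> ?Y \<longrightarrow> sat ?M (e(20 := x)) E (replacement_fm 20 Y))"
    by (simp add: universe_like_fm_def mem_iff_elts)
  also have "\<dots> \<longleftrightarrow>
     (\<forall>x \<in> ?Y. elts x \<subseteq> ?Y) \<and>
     (\<forall>x \<in> ?Y. \<exists>p \<in> ?Y. \<forall>z. elts z \<subseteq> elts x \<longrightarrow> z \<in> elts p) \<and>
     (\<exists>x \<in> ?Y. elts x \<noteq> {} \<and> (\<forall>y \<in> elts x. \<exists>z \<in> elts x. y \<in> elts z)) \<and>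
     (\<forall>x \<in> ?Y. sat ?M (e(20 := x)) E (replacement_fm 20 Y))"
  proof -
    have "(\<forall>x \<in> ?M. x \<in> ?Y \<longrightarrow> (\<forall>y \<in> ?M. y \<in> elts x \<longrightarrow> y \<in> ?Y)) \<longleftrightarrow> (\<forall>x \<in> ?Y. elts x \<subseteq> ?Y)"
      using assms(2) Vset_elts by blast
    moreover have "(\<forall>x \<in> ?M. x \<in> ?Y \<longrightarrow> (\<exists>p \<in> ?M. p \<in> ?Y \<and>
        (\<forall>z \<in> ?M. (\<forall>w \<in> ?M. w \<in> elts z \<longrightarrow> w \<in> elts x) \<longrightarrow> z \<in> elts p))) \<longleftrightarrow>
      (\<forall>x \<in> ?Y. \<exists>p \<in> ?Y. \<forall>z. elts z \<subseteq> elts x \<longrightarrow> z \<in> elts p)"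
      unfolding ball_Vset_subset[OF assms(2)] bex_Vset_subset[OF assms(2)]
      by (intro ball_cong refl bex_cong pow) (use assms(2) in blast)
    moreover have "(\<exists>x \<in> ?M. x \<in> ?Y \<and> (\<exists>y \<in> ?M. y \<in> elts x) \<and>
        (\<forall>y \<in> ?M. y \<in> elts x \<longrightarrow> (\<exists>z \<in> ?M. z \<in> elts x \<and> y \<in> elts z))) \<longleftrightarrow>
      (\<exists>x \<in> ?Y. elts x \<noteq> {} \<and> (\<forall>y \<in> elts x. \<exists>z \<in> elts x. y \<in> elts z))"
      unfolding bex_Vset_subset[OF assms(2)]
      by (rule bex_cong[OF refl]) (use assms(2) in \<open>simp add: sub subset_iff\<close>)
    ultimately show ?thesis
      by (simp only: ball_Vset_subset[OF assms(2)])
  qed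
  also have "\<dots> \<longleftrightarrow> universe_like ?Y"
  proof -
    have *: "sat ?M (e(20 := x)) E (replacement_fm 20 Y) \<longleftrightarrow>
        (\<forall>f. f ` elts x \<subseteq> ?Y \<longrightarrow> (\<exists>s \<in> ?Y. transitive_set s \<and> elts x \<union> f ` elts x \<subseteq> elts s))"
      if "x \<in> ?Y" "\<forall>x \<in> ?Y. elts x \<subseteq> ?Y" for x
    proof -
      have "x \<in> ?M" using that(1) assms(2) by blast
      then have "sat ?M (e(20 := x)) E (replacement_fm 20 Y) \<longleftrightarrow>
        (\<forall>F \<subseteq> ?M. \<forall>Z \<subseteq> ?Y. codes_onto x F Z \<longrightarrow>
          (\<exists>s \<in> ?Y. transitive_set s \<and> elts x \<union> Z \<subseteq> elts s))"
        using sat_replacement_fm[of 20 Y "e(20 := x)" E] assms by simp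
      also have "\<dots> \<longleftrightarrow>
        (\<forall>f. f ` elts x \<subseteq> ?Y \<longrightarrow> (\<exists>s \<in> ?Y. transitive_set s \<and> elts x \<union> f ` elts x \<subseteq> elts s))"
        by (rule replacement_coded[OF assms(2) _ that(1), symmetric]) (use that(2) in blast)
      finally show ?thesis .
    qed
    \<comment> \<open>\<open>conj_cong\<close> hands the transitivity clause on to the replacement
      clause, where the coding needs it.\<close>
    show ?thesis
      unfolding universe_like_def by (intro conj_cong refl ball_cong *; assumption)
  qed
  finally show ?thesis .
qed

lemma sat_inaccessible_fm:
  assumes "m < 100" "m \<noteq> 30" "e m \<in> elts \<kappa>"
  shows "sat (Vset \<kappa>) e E (inaccessible_fm m) \<longleftrightarrow> inaccessible (e m)"
proof -
  have "e m \<in> Vset \<kappa>" using assms(3) ordinal_in_Vset[OF ordinal] by blast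
  then show ?thesis
    unfolding inaccessible_elem_iff[OF assms(3)] inaccessible_fm_def
    using assms(1,2) 
    by (simp add: sat_universe_like_fm sat_ordinal_fm mem_iff_elts cong: conj_cong)
qed

lemma sat_club_fm:
  assumes "K \<noteq> C" "elts \<mu> \<subseteq> elts \<kappa>" "E K = elts \<mu>" "E C \<subseteq> Vset \<kappa>"
  shows "sat (Vset \<kappa>) e E (club_fm C K) \<longleftrightarrow> club (E C) \<mu>"
proof -
  let ?M = "Vset \<kappa>"
  have \<mu>: "elts \<mu> \<subseteq> ?M" using assms(2) ordinal_in_Vset[OF ordinal] by blast
  have "sat ?M e E (club_fm C K) \<longleftrightarrow>
     (\<forall>x \<in> ?M. x \<in> E C \<longrightarrow> x \<in> elts \<mu>) \<and>
     (\<forall>x \<in> ?M. x \<in> elts \<mu> \<longrightarrow> (\<exists>y \<in> ?M. y \<in> elts x) \<and>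
        (\<forall>y \<in> ?M. y \<in> elts x \<longrightarrow> (\<exists>z \<in> ?M. z \<in> E C \<and> z \<in> elts x \<and> y \<in> elts z)) \<longrightarrow> x \<in> E C) \<and>
     (\<forall>x \<in> ?M. x \<in> elts \<mu> \<longrightarrow> (\<exists>y \<in> ?M. y \<in> E C \<and> x \<in> elts y))"
    using assms(1,3) by (simp add: club_fm_def mem_iff_elts)
  also have "\<dots> \<longleftrightarrow> E C \<subseteq> elts \<mu> \<and>
     (\<forall>x \<in> elts \<mu>. elts x \<noteq> {} \<and> (\<forall>y \<in> elts x. \<exists>z \<in> E C \<inter> elts x. y \<in> elts z) \<longrightarrow> x \<in> E C) \<and>
     (\<forall>x \<in> elts \<mu>. \<exists>y \<in> E C. x \<in> elts y)"
  proof -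
    have "(\<exists>y \<in> ?M. y \<in> elts x) \<and>
        (\<forall>y \<in> ?M. y \<in> elts x \<longrightarrow> (\<exists>z \<in> ?M. z \<in> E C \<and> z \<in> elts x \<and> y \<in> elts z)) \<longleftrightarrow>
      elts x \<noteq> {} \<and> (\<forall>y \<in> elts x. \<exists>z \<in> E C \<inter> elts x. y \<in> elts z)" if "x \<in> ?M" for x
      using Vset_elts[OF that] assms(4) by blast
    then have "(\<forall>x \<in> ?M. x \<in> elts \<mu> \<longrightarrow> (\<exists>y \<in> ?M. y \<in> elts x) \<and>
        (\<forall>y \<in> ?M. y \<in> elts x \<longrightarrow> (\<exists>z \<in> ?M. z \<in> E C \<and> z \<in> elts x \<and> y \<in> elts z)) \<longrightarrow> x \<in> E C) \<longleftrightarrow>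
      (\<forall>x \<in> elts \<mu>. elts x \<noteq> {} \<and> (\<forall>y \<in> elts x. \<exists>z \<in> E C \<inter> elts x. y \<in> elts z) \<longrightarrow> x \<in> E C)"
      unfolding ball_Vset_subset[OF \<mu>] by (intro ball_cong refl) (use \<mu> in auto)
    moreover have "(\<forall>x \<in> ?M. x \<in> E C \<longrightarrow> x \<in> elts \<mu>) \<longleftrightarrow> E C \<subseteq> elts \<mu>"
      using assms(4) by blast
    moreover have "(\<forall>x \<in> ?M. x \<in> elts \<mu> \<longrightarrow> (\<exists>y \<in> ?M. y \<in> E C \<and> x \<in> elts y)) \<longleftrightarrow>
        (\<forall>x \<in> elts \<mu>. \<exists>y \<in> E C. x \<in> elts y)"
      unfolding ball_Vset_subset[OF \<mu>] bex_Vset_subset[OF assms(4)] ..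
    ultimately show ?thesis by (simp only:)
  qed
  also have "\<dots> \<longleftrightarrow> club (E C) \<mu>"
    unfolding club_def closed_in_def unbounded_in_def mem_iff_elts by blast
  finally show ?thesis .
qed

text \<open>Requiring inclusion in \<kappa> rather than membership covers \<mu> = \<kappa> as
  well.\<close>

lemma sat_stationary_inaccessibles_fm:
  assumes "K \<notin> {0, 1}" "elts \<mu> \<subseteq> elts \<kappa>" "E K = elts \<mu>"
  shows "sat (Vset \<kappa>) e E (stationary_inaccessibles_fm K) \<longleftrightarrow>
    stationary {\<nu> \<in> elts \<mu>. inaccessible \<nu>} \<mu>"
proof -
  let ?M = "Vset \<kappa>"
  have \<mu>: "elts \<mu> \<subseteq> ?M" using assms(2) ordinal_in_Vset[OF ordinal] by blast
  have "sat ?M e E (stationary_inaccessibles_fm K) \<longleftrightarrow>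
    (\<forall>C \<subseteq> ?M. club C \<mu> \<longrightarrow> (\<exists>x \<in> ?M. x \<in> C \<and> sat ?M (e(50 := x)) (E(1 := C)) (inaccessible_fm 50)))"
    using assms sat_club_fm[of K 1 \<mu> "E(1 := C)" for C]
    by (simp add: stationary_inaccessibles_fm_def)
  also have "\<dots> \<longleftrightarrow> (\<forall>C. club C \<mu> \<longrightarrow> (\<exists>x \<in> C. inaccessible x))"
  proof -
    \<comment> \<open>A club in \<mu> is a subset of \<kappa>: it is in the range of the class
      quantifier, and its elements are ordinals below \<kappa>, where
      \<open>sat_inaccessible_fm\<close> applies.\<close>
    have *: "C \<subseteq> ?M \<and> (\<forall>x \<in> C. sat ?M (e(50 := x)) (E(1 := C)) (inaccessible_fm 50) \<longleftrightarrow> inaccessible x)"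
      if "club C \<mu>" for C
      using that \<mu> assms(2) sat_inaccessible_fm[of 50 "e(50 := x)" for x] by (auto simp: club_def)
    have "(C \<subseteq> ?M \<longrightarrow> club C \<mu> \<longrightarrow>
        (\<exists>x \<in> ?M. x \<in> C \<and> sat ?M (e(50 := x)) (E(1 := C)) (inaccessible_fm 50))) \<longleftrightarrow>
      (club C \<mu> \<longrightarrow> (\<exists>x \<in> C. inaccessible x))" for C
      using *[of C] by blast
    then show ?thesis by (rule all_cong1)
  qed
  also have "\<dots> \<longleftrightarrow> stationary {\<nu> \<in> elts \<mu>. inaccessible \<nu>} \<mu>"
    unfolding stationary_def club_def by blast
  finally show ?thesis .
qed

lemma sat_least_Mahlo_fm:
  "sat (Vset \<kappa>) e E least_Mahlo_fm \<longleftrightarrow> Mahlo \<kappa> \<and> (\<forall>\<mu> \<in> elts \<kappa>. \<not> Mahlo \<mu>)"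
proof -
  let ?M = "Vset \<kappa>"
  have \<kappa>: "elts \<kappa> \<subseteq> ?M" using ordinal_in_Vset[OF ordinal] by blast
  have smaller: "sat ?M (e(60 := \<mu>)) (E(2 := elts \<kappa>)) (inaccessible_fm 60) \<and>
      (\<exists>X \<subseteq> ?M. (\<forall>x \<in> ?M. x \<in> X \<longleftrightarrow> x \<in> elts \<mu>) \<and>
        sat ?M (e(60 := \<mu>)) (E(2 := elts \<kappa>, 3 := X)) (stationary_inaccessibles_fm 3)) \<longleftrightarrow> Mahlo \<mu>"
    if \<mu>: "\<mu> \<in> elts \<kappa>" for \<mu>
  proof -
    have sub: "elts \<mu> \<subseteq> elts \<kappa>" using \<mu> trans by blast
    then have "elts \<mu> = {x \<in> ?M. x \<in> elts \<mu>}" using \<kappa> by blast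
    have "sat ?M (e(60 := \<mu>)) (E(2 := elts \<kappa>, 3 := elts \<mu>)) (stationary_inaccessibles_fm 3) \<longleftrightarrow>
        stationary {\<nu> \<in> elts \<mu>. inaccessible \<nu>} \<mu>"
      by (rule sat_stationary_inaccessibles_fm) (use sub in auto)
    moreover have "sat ?M (e(60 := \<mu>)) (E(2 := elts \<kappa>)) (inaccessible_fm 60) \<longleftrightarrow> inaccessible \<mu>"
      using sat_inaccessible_fm[of 60 "e(60 := \<mu>)"] \<mu> by simp
    ultimately show ?thesis
      unfolding Mahlo_def ex_subset_Vset[OF \<open>elts \<mu> = {x \<in> ?M. x \<in> elts \<mu>}\<close>] by (simp only:)
  qed
  have top: "sat ?M e (E(2 := elts \<kappa>)) (stationary_inaccessibles_fm 2) \<longleftrightarrow> Mahlo \<kappa>"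
    using sat_stationary_inaccessibles_fm[of 2 \<kappa> "E(2 := elts \<kappa>)"] inaccessible
    by (simp add: Mahlo_def)
  have "sat ?M e E least_Mahlo_fm \<longleftrightarrow>
    (\<exists>X \<subseteq> ?M. (\<forall>x \<in> ?M. x \<in> X \<longleftrightarrow> ordinal x) \<and>
      sat ?M e (E(2 := X)) (stationary_inaccessibles_fm 2) \<and>
      (\<forall>\<mu> \<in> ?M. \<mu> \<in> X \<and> sat ?M (e(60 := \<mu>)) (E(2 := X)) (inaccessible_fm 60) \<longrightarrow>
        \<not> (\<exists>X' \<subseteq> ?M. (\<forall>x \<in> ?M. x \<in> X' \<longleftrightarrow> x \<in> elts \<mu>) \<and>
          sat ?M (e(60 := \<mu>)) (E(2 := X, 3 := X')) (stationary_inaccessibles_fm 3))))"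
    by (simp add: least_Mahlo_fm_def sat_ordinal_fm mem_iff_elts cong: ball_cong_simp)
  also have "\<dots> \<longleftrightarrow>
      sat ?M e (E(2 := elts \<kappa>)) (stationary_inaccessibles_fm 2) \<and>
      (\<forall>\<mu> \<in> ?M. \<mu> \<in> elts \<kappa> \<and> sat ?M (e(60 := \<mu>)) (E(2 := elts \<kappa>)) (inaccessible_fm 60) \<longrightarrow>
        \<not> (\<exists>X' \<subseteq> ?M. (\<forall>x \<in> ?M. x \<in> X' \<longleftrightarrow> x \<in> elts \<mu>) \<and>
          sat ?M (e(60 := \<mu>)) (E(2 := elts \<kappa>, 3 := X')) (stationary_inaccessibles_fm 3)))"
    by (rule ex_subset_Vset) (rule Vset_ordinals[OF ordinal, symmetric])
  also have "\<dots> \<longleftrightarrow> Mahlo \<kappa> \<and> (\<forall>\<mu> \<in> elts \<kappa>. \<not> Mahlo \<mu>)"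
  proof -
    have *: "(\<forall>\<mu> \<in> ?M. \<mu> \<in> elts \<kappa> \<and> A \<mu> \<longrightarrow> \<not> B \<mu>) \<longleftrightarrow> (\<forall>\<mu> \<in> elts \<kappa>. \<not> (A \<mu> \<and> B \<mu>))" for A B
      using \<kappa> by blast
    show ?thesis
      unfolding top * by (intro conj_cong refl ball_cong arg_cong[where f = Not] smaller)
  qed
  finally show ?thesis .
qed

lemma Vset_models_least_Mahlo_fm:
  "Vset \<kappa> \<Turnstile> least_Mahlo_fm \<longleftrightarrow> Mahlo \<kappa> \<and> (\<forall>\<mu> \<in> elts \<kappa>. \<not> Mahlo \<mu>)"
proof -
  \<comment> \<open>A constant assignment shows that \<open>models\<close> does not hold
    vacuously.\<close>
  obtain x where "x \<in> Vset \<kappa>" using universe_like_Vset by (auto simp: universe_like_def)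
  then have "range (\<lambda>_ :: nat. x) \<subseteq> Vset \<kappa>" "\<forall>n :: nat. {} \<subseteq> Vset \<kappa>" by auto
  then show ?thesis unfolding models_def sat_least_Mahlo_fm by blast
qed

end

section \<open>Minimality among Mahlo cardinals and the two conclusions\<close>

lemma Mahlo_ordinal: "Mahlo \<kappa> \<Longrightarrow> ordinal \<kappa>"
  by (simp add: Mahlo_def inacc.intro inacc.ordinal)

text \<open>Comparability of ordinals replaces the quantifier over all Mahlo cardinals by one over
  elements of \<kappa>, which V_\<kappa> can express.\<close>

lemma least_Mahlo_iff: "least_Mahlo \<kappa> \<longleftrightarrow> Mahlo \<kappa> \<and> (\<forall>\<mu> \<in> elts \<kappa>. \<not> Mahlo \<mu>)"
proof
  assume \<kappa>: "least_Mahlo \<kappa>"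
  have "\<not> Mahlo \<mu>" if "\<mu> \<in> elts \<kappa>" for \<mu>
  proof
    assume "Mahlo \<mu>"
    then have "\<kappa> = \<mu> \<or> \<kappa> \<in> elts \<mu>" using \<kappa> by (simp add: least_Mahlo_def mem_iff_elts)
    then show False
      using that not_mem_self[of \<mu>] ordinal_trans[OF Mahlo_ordinal[OF \<open>Mahlo \<mu>\<close>]] by blast
  qed
  then show "Mahlo \<kappa> \<and> (\<forall>\<mu> \<in> elts \<kappa>. \<not> Mahlo \<mu>)" using \<kappa> by (simp add: least_Mahlo_def)
next
  assume "Mahlo \<kappa> \<and> (\<forall>\<mu> \<in> elts \<kappa>. \<not> Mahlo \<mu>)"
  then show "least_Mahlo \<kappa>"
    unfolding least_Mahlo_def mem_iff_elts using ordinal_linear Mahlo_ordinal by blast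
qed

lemma least_Mahlo_second_order_sententially_categorical:
  assumes "least_Mahlo \<kappa>" shows "second_order_sententially_categorical \<kappa>"
  unfolding second_order_sententially_categorical_def
proof (intro exI[of _ least_Mahlo_fm] conjI allI impI sentence_least_Mahlo_fm)
  show "inaccessible \<kappa>" using assms by (simp add: least_Mahlo_def Mahlo_def)
  then show "Vset \<kappa> \<Turnstile> least_Mahlo_fm"
    using assms by (simp add: inacc.intro inacc.Vset_models_least_Mahlo_fm least_Mahlo_iff)
  fix \<mu> assume \<mu>: "inaccessible \<mu> \<and> \<mu> \<noteq> \<kappa>"
  show "\<not> Vset \<mu> \<Turnstile> least_Mahlo_fm"
  proof
    assume "Vset \<mu> \<Turnstile> least_Mahlo_fm"
    then have "least_Mahlo \<mu>"
      using \<mu> by (simp add: inacc.intro inacc.Vset_models_least_Mahlo_fm least_Mahlo_iff)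
    then have "\<mu> = \<kappa>"
      using assms ordinal_linear[of \<mu> \<kappa>] Mahlo_ordinal unfolding least_Mahlo_iff by blast
    then show False using \<mu> by blast
  qed
qed

theorem theorem11:
  assumes "\<exists>\<mu> :: 'v::zfc_universe. Mahlo \<mu>"
  shows "\<exists>\<kappa> :: 'v. least_Mahlo \<kappa> \<and>
           second_order_sententially_categorical \<kappa> \<and>
           \<not> first_order_theory_categorical \<kappa>"
proof -
  obtain \<mu> :: 'v where "Mahlo \<mu>" using assms by blast
  then obtain \<kappa> :: 'v where "Mahlo \<kappa>" "\<And>\<mu>. \<mu> \<in> elts \<kappa> \<Longrightarrow> \<not> Mahlo \<mu>"
    using ordinal_least[OF Mahlo_ordinal, of \<mu> Mahlo] by blast
  then have "least_Mahlo \<kappa>" by (simp add: least_Mahlo_iff)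
  then show ?thesis
    using least_Mahlo_second_order_sententially_categorical
      Mahlo_not_first_order_theory_categorical \<open>Mahlo \<kappa>\<close> by blast
qed

end
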